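(* Let $H$ be a real Hilbert space and let $A$ be a linear operator on $H$ that is unitarily equivalent to a non-negative multiplication operator (in the sense specified in the context), with $A$ not identically zero. Let $t_0$ be a positive real number. Then for every pair of real numbers $a\geq r>0$ there exists a damping coefficient $b:[t_0,+\infty)\to\mathbb{R}$ of class $C^{\infty}$ with the following properties. (1) The damping coefficient $b$ satisfies $$\frac{a-r}{t}\leq b(t)\leq\frac{a+r}{t}\qquad\forall t\geq t_0.$$ (2) The limit $$\lim_{t\to+\infty}\left(\frac{t_0}{t}\right)^{a}\exp\left(\int_{t_0}^{t}b(s)\,ds\right)$$ exists and is a real number. (3) There exists a positive real number $\Gamma_3$, depending on $t_0$, $a$, $r$ and on the operator $A$, such that $$\mathcal{E}(t)\geq\frac{\Gamma_3}{t^{a-r/2}}\qquad\forall t\geq t_0,$$ where $$\mathcal{E}(t):=\sup\left\{|u'(t)|^2+|A^{1/2}u(t)|^2:(u_0,u_1)\in D(A^{1/2})\times H,\ |u_1|^2+|A^{1/2}u_0|^2+|u_0|^2\leq 1\right\}$$ and, for each $(u_0,u_1)$, $u$ denotes the solution to $$u''(t)+b(t)u'(t)+Au(t)=0\quad(t\geq t_0),\qquad u(t_0)=u_0,\quad u'(t_0)=u_1.$$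
   Context: Functional setting. $H$ is a real Hilbert space with norm $|\cdot|$, and $A$ is a linear operator on $H$ with domain $D(A)$, unitarily equivalent to a non-negative multiplication operator: there exist a measure space $(\mathcal{M},\nu)$, a measurable function $\lambda:\mathcal{M}\to[0,+\infty)$ and a surjective linear isometry $\mathscr{F}:H\to L^2(\mathcal{M},\nu)$ (real-valued functions) such that $u\in D(A)$ if and only if $\lambda(\xi)^2[\mathscr{F}u](\xi)\in L^2(\mathcal{M},\nu)$, and $[\mathscr{F}(Au)](\xi)=\lambda(\xi)^2[\mathscr{F}u](\xi)$ for every $u\in D(A)$. Writing $\widehat{u}=\mathscr{F}u$, for $\beta>0$ the space $D(A^{\beta})$ is the set of $u\in H$ with $\int_{\mathcal{M}}\lambda(\xi)^{4\beta}\widehat{u}(\xi)^2\,d\nu(\xi)<+\infty$, and for such $u$ one has $|A^{\beta}u|^2=\int_{\mathcal{M}}\lambda(\xi)^{4\beta}\widehat{u}(\xi)^2\,d\nu(\xi)$. Solutions. If $b\in L^1((t_0,T))$ for every $T>t_0$, the solution of $u''+b(t)u'+Au=0$ with $u(t_0)=u_0\in D(A^{1/2})$, $u'(t_0)=u_1\in H$ is defined as $u(t):=\mathscr{F}^{-1}\widehat{u}(t,\cdot)$, where for each $\xi\in\mathcal{M}$ the function $t\mapsto\widehat{u}(t,\xi)$ solves the ordinary differential equation $\widehat{u}\,''(t,\xi)+b(t)\widehat{u}\,'(t,\xi)+\lambda(\xi)^2\widehat{u}(t,\xi)=0$ (primes are time derivatives), with $\widehat{u}(t_0,\xi)=[\mathscr{F}u_0](\xi)$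 and $\widehat{u}\,'(t_0,\xi)=[\mathscr{F}u_1](\xi)$. This is the unique solution in $C^0([t_0,+\infty),D(A^{1/2}))\cap C^1([t_0,+\infty),H)$. *)

theory Defs
  imports "HOL-Analysis.Analysis"
begin

text \<open>
  The library has no type of square-integrable functions modulo null sets. Elements of
  $L^2(M)$ are therefore given by representatives, and equality in $L^2(M)$ is equality
  almost everywhere.
\<close>

definition L2 :: "'m measure \<Rightarrow> ('m \<Rightarrow> real) set" where
  "L2 M = {f \<in> borel_measurable M. integrable M (\<lambda>\<xi>. (f \<xi>)\<^sup>2)}"

definition L2_isometry ::
  "'m measure \<Rightarrow> ('h::{real_inner,complete_space} \<Rightarrow> 'm \<Rightarrow> real) \<Rightarrow> bool" where
  "L2_isometry M F \<longleftrightarrow>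
     (\<forall>u. F u \<in> L2 M) \<and>
     (\<forall>u v. AE \<xi> in M. F (u + v) \<xi> = F u \<xi> + F v \<xi>) \<and>
     (\<forall>c u. AE \<xi> in M. F (c *\<^sub>R u) \<xi> = c * F u \<xi>) \<and>
     (\<forall>u. (\<integral>\<xi>. (F u \<xi>)\<^sup>2 \<partial>M) = (norm u)\<^sup>2) \<and>
     (\<forall>f\<in>L2 M. \<exists>u. AE \<xi> in M. F u \<xi> = f \<xi>)"

text \<open>An unbounded operator is a pair of a domain \<open>D\<close> and a function \<open>A\<close>, whose values
  outside \<open>D\<close> are irrelevant.\<close>

definition linear_operator :: "'h::real_vector set \<Rightarrow> ('h \<Rightarrow> 'h) \<Rightarrow> bool" where
  "linear_operator D A \<longleftrightarrow>
     subspace D \<and>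
     (\<forall>u\<in>D. \<forall>v\<in>D. A (u + v) = A u + A v) \<and>
     (\<forall>c. \<forall>u\<in>D. A (c *\<^sub>R u) = c *\<^sub>R A u)"

definition equivalent_to_multiplication ::
  "'h::{real_inner,complete_space} set \<Rightarrow> ('h \<Rightarrow> 'h) \<Rightarrow>
   'm measure \<Rightarrow> ('m \<Rightarrow> real) \<Rightarrow> ('h \<Rightarrow> 'm \<Rightarrow> real) \<Rightarrow> bool" where
  "equivalent_to_multiplication D A M lam F \<longleftrightarrow>
     lam \<in> borel_measurable M \<and> (\<forall>\<xi>\<in>space M. 0 \<le> lam \<xi>) \<and>
     L2_isometry M F \<and>
     (\<forall>u. u \<in> D \<longleftrightarrow> (\<lambda>\<xi>. (lam \<xi>)\<^sup>2 * F u \<xi>) \<in> L2 M) \<and>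
     (\<forall>u\<in>D. AE \<xi> in M. F (A u) \<xi> = (lam \<xi>)\<^sup>2 * F u \<xi>)"

definition dom_power ::
  "'m measure \<Rightarrow> ('m \<Rightarrow> real) \<Rightarrow> ('h \<Rightarrow> 'm \<Rightarrow> real) \<Rightarrow> real \<Rightarrow> 'h set" where
  "dom_power M lam F \<beta> = {u. integrable M (\<lambda>\<xi>. lam \<xi> powr (4 * \<beta>) * (F u \<xi>)\<^sup>2)}"

text \<open>For \<open>\<beta> > 0\<close>; since \<open>A\<close> acts as multiplication by $\lambda^2$, its power acts as
  multiplication by $\lambda^{2\beta}$.\<close>

definition op_power ::
  "'m measure \<Rightarrow> ('m \<Rightarrow> real) \<Rightarrow> ('h \<Rightarrow> 'm \<Rightarrow> real) \<Rightarrow> real \<Rightarrow> 'h \<Rightarrow> 'h" where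
  "op_power M lam F \<beta> u = (THE v. AE \<xi> in M. F v \<xi> = lam \<xi> powr (2 * \<beta>) * F u \<xi>)"

text \<open>Class $C^\infty$ up to the boundary: \<open>d n\<close> is the \<open>n\<close>-th derivative, one-sided at
  end points belonging to \<open>S\<close>.\<close>

definition C_infinity_on :: "real set \<Rightarrow> (real \<Rightarrow> real) \<Rightarrow> bool" where
  "C_infinity_on S f \<longleftrightarrow>
     (\<exists>d :: nat \<Rightarrow> real \<Rightarrow> real.
        (\<forall>t\<in>S. d 0 t = f t) \<and>
        (\<forall>n. \<forall>t\<in>S. (d n has_real_derivative d (Suc n) t) (at t within S)))"

text \<open>\<open>y\<close> solves $y'' + b y' + l^2 y = 0$ on $[t_0,\infty)$ with initial data \<open>y0\<close>, \<open>y1\<close>,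
  in the classical sense, which is the appropriate one for continuous \<open>b\<close>.\<close>

definition damped_ode_solution ::
  "real \<Rightarrow> (real \<Rightarrow> real) \<Rightarrow> real \<Rightarrow> real \<Rightarrow> real \<Rightarrow> (real \<Rightarrow> real) \<Rightarrow> bool" where
  "damped_ode_solution t0 b l y0 y1 y \<longleftrightarrow>
     (\<exists>y'. y t0 = y0 \<and> y' t0 = y1 \<and>
        (\<forall>t\<ge>t0. (y has_real_derivative y' t) (at t within {t0..}) \<and>
                (y' has_real_derivative (- b t * y' t - l\<^sup>2 * y t)) (at t within {t0..})))"

definition wave_solution ::
  "'m measure \<Rightarrow> ('m \<Rightarrow> real) \<Rightarrow> ('h \<Rightarrow> 'm \<Rightarrow> real) \<Rightarrow>
   real \<Rightarrow> (real \<Rightarrow> real) \<Rightarrow> 'h \<Rightarrow> 'h \<Rightarrow> (real \<Rightarrow> 'h) \<Rightarrow> bool" where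
  "wave_solution M lam F t0 b u0 u1 u \<longleftrightarrow>
     (\<exists>w :: real \<Rightarrow> 'm \<Rightarrow> real.
        (\<forall>\<xi>\<in>space M. damped_ode_solution t0 b (lam \<xi>) (F u0 \<xi>) (F u1 \<xi>) (\<lambda>t. w t \<xi>)) \<and>
        (\<forall>t\<ge>t0. AE \<xi> in M. F (u t) \<xi> = w t \<xi>))"

text \<open>The supremum is taken in the extended reals, so that it is meaningful without a prior
  proof of boundedness. The bound variable \<open>u\<close> ranges over the solution with data \<open>u0\<close>, \<open>u1\<close>,
  which is unique on $[t_0,\infty)$.\<close>

definition max_energy ::
  "'m measure \<Rightarrow> ('m \<Rightarrow> real) \<Rightarrow> ('h::{real_inner,complete_space} \<Rightarrow> 'm \<Rightarrow> real) \<Rightarrow>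
   real \<Rightarrow> (real \<Rightarrow> real) \<Rightarrow> real \<Rightarrow> ereal" where
  "max_energy M lam F t0 b t =
     Sup {ereal ((norm (vector_derivative u (at t within {t0..})))\<^sup>2
                 + (norm (op_power M lam F (1/2) (u t)))\<^sup>2) | u0 u1 u.
            u0 \<in> dom_power M lam F (1/2) \<and>
            (norm u1)\<^sup>2 + (norm (op_power M lam F (1/2) u0))\<^sup>2 + (norm u0)\<^sup>2 \<le> 1 \<and>
            wave_solution M lam F t0 b u0 u1 u}"

end

theory Submission
  imports Defs
begin

text \<open>
  An oscillator of frequency $\omega$ with damping $b$ loses energy at the rate
  $2b\,y'^2$. In polar form $y=\varrho\cos\theta$, $y'=-\omega\varrho\sin\theta$ this reads
  $\varrho'/\varrho=-b\sin^2\theta$, so a damping that is small exactly when the kinetic energy is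
  large dissipates less than its average suggests. The choice
  \[b(t)=\frac{a+r\cos(2\theta(t))}{t}\]
  stays between $(a-r)/t$ and $(a+r)/t$ by construction. Substituting it turns the equation for the
  phase into a scalar equation for $\theta$ alone,
  \[\theta'=\omega-\frac{(a+r\cos2\theta)\sin2\theta}{2t},\]
  which has a global solution (\<open>resonant_phase_exists\<close>). Because the damping is
  synchronised exactly with the phase, the amplitude $\varrho$ is the exponential of an explicit
  integral, and as
  $\int\cos(k\theta)\,dt/t$ converges (\<open>oscillating_integral\<close>), $\varrho^2$ is comparable to
  $t^{-(a-r/2)}$, while $\int b-a\log t$ converges (\<open>resonant_damping\<close>). Smoothness of $b$
  follows from the fact that $1/t$, $\cos2\theta$ and $\sin2\theta$ generate an algebra closed under
  differentiation.

  The frequency $\omega$ must be one that the operator sees. Since $A\ne0$, some positive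
  $\omega$ has the property that every neighbourhood of it is charged by $|Fu|^2$ for one fixed $u$
  (\<open>positive_frequency_exists\<close>). For each time $t$, data concentrated close enough to
  $\omega$, depending on $t$, have at time $t$, relative to their size, at least half of the energy of the
  exact oscillator of frequency $\omega$ (\<open>max_energy_ge_frequency_energy\<close>). Continuity of the
  oscillators in the frequency and the time derivative of the solution in the Hilbert space come
  from solving one equation in the Banach space of bounded continuous functions of
  the frequency (\<open>damped_family_exists\<close>), with the same existence theorem that gives the phase
  (\<open>picard_lindelof_global\<close>).
\<close>

section \<open>Ordinary differential equations in Banach spaces\<close>

lemma at_within_atLeast_eq_atLeastAtMost:
  fixes t :: real
  assumes "t < c"
  shows "at t within {t0..} = at t within {t0..c}"
  by (rule at_within_nhd[of t "{..<c}"]) (use assms in auto)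

lemma integral_exp_weight_bound:
  fixes g :: "real \<Rightarrow> 'a::banach"
  assumes K: "0 < K" and t: "t0 \<le> t" and B: "0 \<le> B"
    and cont: "continuous_on {t0..t} g"
    and bound: "\<And>s. s \<in> {t0..t} \<Longrightarrow> norm (g s) \<le> B * exp (K * (s - t0))"
  shows "norm (integral {t0..t} g) \<le> B / K * exp (K * (t - t0))"
proof -
  have "((\<lambda>s. B * exp (K * (s - t0))) has_integral
          B / K * exp (K * (t - t0)) - B / K * exp (K * (t0 - t0))) {t0..t}"
    by (rule fundamental_theorem_of_calculus[OF t])
       (use K in \<open>auto intro!: derivative_eq_intros
          simp flip: has_real_derivative_iff_has_vector_derivative\<close>)
  then have hi: "((\<lambda>s. B * exp (K * (s - t0))) has_integral
          B / K * exp (K * (t - t0)) - B / K) {t0..t}"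
    by simp
  have "norm (integral {t0..t} g) \<le> integral {t0..t} (\<lambda>s. B * exp (K * (s - t0)))"
    by (rule integral_norm_bound_integral)
       (use cont bound hi in \<open>auto intro: integrable_continuous_interval has_integral_integrable\<close>)
  also have "\<dots> = B / K * exp (K * (t - t0)) - B / K"
    using hi by (rule integral_unique)
  also have "\<dots> \<le> B / K * exp (K * (t - t0))"
    using K B by simp
  finally show ?thesis .
qed

text \<open>
  The integral operator of the initial value problem is a contraction on $[t_0,\infty)$ for the
  norm $\sup_t e^{-K(t-t_0)}|x(t)|$ with $K$ at least twice the Lipschitz constant, so one
  application of Banach's theorem gives a solution for all times. The unknown of the fixed point problem is
  $z(t)=e^{-K(t-t_0)}x(t)$, a bounded continuous function, extended by its value at $t_0$ to the left of $t_0$.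
\<close>

lemma picard_lindelof_global:
  fixes f :: "real \<Rightarrow> 'a::banach \<Rightarrow> 'a"
  assumes cont: "continuous_on ({t0..} \<times> UNIV) (\<lambda>p. f (fst p) (snd p))"
    and lip: "\<And>t x y. t0 \<le> t \<Longrightarrow> norm (f t x - f t y) \<le> L * norm (x - y)"
    and bd: "\<And>t. t0 \<le> t \<Longrightarrow> norm (f t 0) \<le> C"
  obtains x where "x t0 = x0"
    and "\<And>t. t0 \<le> t \<Longrightarrow> (x has_vector_derivative f t (x t)) (at t within {t0..})"
proof -
  define K where "K = 2 * max L 1"
  have K: "0 < K" "L \<le> K / 2" by (auto simp: K_def)
  have C: "0 \<le> C" using bd[of t0] norm_ge_zero order_trans by blast
  define E where "E t = exp (K * (t - t0))" for t
  have E0: "0 < E t" for t by (simp add: E_def)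
  have E1: "1 \<le> E t" if "t0 \<le> t" for t using that K by (simp add: E_def)
  have contE: "continuous_on S E" for S
    unfolding E_def by (intro continuous_intros)
  define G where "G z s = f s (E s *\<^sub>R apply_bcontfun z s)" for z :: "real \<Rightarrow>\<^sub>C 'a" and s
  have contG: "continuous_on {t0..} (G z)" for z
  proof -
    have "continuous_on {t0..} (\<lambda>s. (\<lambda>p. f (fst p) (snd p)) (s, E s *\<^sub>R apply_bcontfun z s))"
      by (rule continuous_on_compose2[OF cont]) (auto intro!: continuous_intros contE)
    then show ?thesis by (simp add: G_def[abs_def])
  qed
  have contG': "continuous_on {t0..t} (G z)" for z t
    by (rule continuous_on_subset[OF contG]) auto
  have lipK: "norm (f t x - f t y) \<le> K / 2 * norm (x - y)" if "t0 \<le> t" for t x y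
    using lip[OF that, of x y] K(2) by (meson mult_right_mono norm_ge_zero order_trans)
  have G_diff: "norm (G z s - G w s) \<le> K / 2 * norm (z - w) * E s" if "t0 \<le> s" for z w s
  proof -
    have "norm (G z s - G w s) \<le> K / 2 * norm (E s *\<^sub>R z s - E s *\<^sub>R w s)"
      unfolding G_def by (rule lipK[OF that])
    also have "\<dots> = K / 2 * (E s * norm ((z - w) s))"
      using E0[of s] by (simp flip: scaleR_diff_right)
    also have "\<dots> \<le> K / 2 * (E s * norm (z - w))"
      using E0[of s] K(1) by (intro mult_left_mono norm_bounded) auto
    finally show ?thesis by (simp add: mult_ac)
  qed
  have G_bound: "norm (G z s) \<le> (C + K / 2 * norm z) * E s" if "t0 \<le> s" for z s
  proof -
    have "norm (G z s) \<le> norm (G 0 s) + norm (G z s - G 0 s)"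
      by (rule norm_triangle_sub)
    also have "\<dots> \<le> C * E s + K / 2 * norm (z - 0) * E s"
    proof (rule add_mono[OF _ G_diff[OF that]])
      have "norm (G 0 s) \<le> C" using bd[OF that] by (simp add: G_def)
      also have "\<dots> \<le> C * E s" using C E1[OF that] by (simp add: mult_le_cancel_left1)
      finally show "norm (G 0 s) \<le> C * E s" .
    qed
    finally show ?thesis by (simp add: algebra_simps)
  qed
  define P where "P z t = (1 / E (max t0 t)) *\<^sub>R (x0 + integral {t0..max t0 t} (G z))" for z t
  have contI: "continuous_on {t0..} (\<lambda>t. integral {t0..t} (G z))" for z
  proof (rule continuous_on_vector_derivative)
    fix t assume t: "t \<in> {t0..}"
    show "((\<lambda>t. integral {t0..t} (G z)) has_vector_derivative G z t) (at t within {t0..})"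
      using integral_has_vector_derivative[OF contG'[of "t + 1" z], of t] t
      by (subst at_within_atLeast_eq_atLeastAtMost[of t "t+1"]) auto
  qed
  have P_bcontfun: "P z \<in> bcontfun" for z
  proof (rule bcontfun_normI)
    show "continuous_on UNIV (P z)"
      unfolding P_def
      by (intro continuous_intros continuous_on_compose2[OF contI, of _ "\<lambda>t. max t0 t"]
           continuous_on_compose2[OF contE[of UNIV]])
         (use E0 in \<open>auto simp: less_imp_neq[THEN not_sym]\<close>)
    fix t
    let ?t = "max t0 t" and ?B = "C + K / 2 * norm z"
    have "norm (integral {t0..?t} (G z)) \<le> ?B / K * E ?t"
      unfolding E_def
      by (rule integral_exp_weight_bound)
         (use K C G_bound contG' in \<open>auto simp: E_def\<close>)
    moreover have "norm x0 \<le> norm x0 * E ?t"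
      using E1[of ?t] by (simp add: mult_le_cancel_left1)
    ultimately have "norm (x0 + integral {t0..?t} (G z)) \<le> (norm x0 + ?B / K) * E ?t"
      by (intro order_trans[OF norm_triangle_ineq]) (simp add: distrib_right)
    then show "norm (P z t) \<le> norm x0 + ?B / K"
      unfolding P_def using E0[of ?t] by (simp add: divide_le_eq)
  qed
  define Q where "Q z = Bcontfun (P z)" for z
  have Q: "apply_bcontfun (Q z) = P z" for z
    unfolding Q_def by (rule Bcontfun_inverse[OF P_bcontfun])
  have "\<exists>!z. Q z = z"
  proof (rule banach_fix_type[of "1/2"]; (intro allI)?)
    fix z w
    show "dist (Q z) (Q w) \<le> 1 / 2 * dist z w"
    proof (rule dist_bound)
      fix t
      let ?t = "max t0 t"
      have "P z t - P w t = (1 / E ?t) *\<^sub>R integral {t0..?t} (\<lambda>s. G z s - G w s)"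
        unfolding P_def
        by (subst Henstock_Kurzweil_Integration.integral_diff)
           (auto intro!: integrable_continuous_interval contG' simp: algebra_simps)
      moreover have "norm (integral {t0..?t} (\<lambda>s. G z s - G w s))
            \<le> (K / 2 * norm (z - w)) / K * E ?t"
        unfolding E_def
        by (rule integral_exp_weight_bound)
           (use K G_diff contG' in \<open>auto simp: E_def intro!: continuous_intros\<close>)
      ultimately have "norm (P z t - P w t) \<le> (1 / E ?t) * ((K / 2 * norm (z - w)) / K * E ?t)"
        using mult_left_mono[of _ _ "1 / E ?t"] E0[of ?t]
        by (simp del: times_divide_eq_left times_divide_eq_right)
      also have "\<dots> = 1 / 2 * dist z w"
        using E0[of ?t] K(1) by (simp add: dist_norm)
      finally show "dist (Q z t) (Q w t) \<le> 1 / 2 * dist z w"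
        by (simp add: Q dist_norm)
    qed
  qed auto
  then obtain z where z: "Q z = z" by blast
  define x where "x t = E t *\<^sub>R z t" for t
  have x_eq: "x t = x0 + integral {t0..t} (G z)" if "t0 \<le> t" for t
  proof -
    have "z t = P z t" using z Q by metis
    then show ?thesis
      using that E0[of t] by (simp add: x_def P_def max_absorb2)
  qed
  show thesis
  proof
    show "x t0 = x0" by (simp add: x_eq)
    fix t assume t: "t0 \<le> t"
    have "((\<lambda>t. x0 + integral {t0..t} (G z)) has_vector_derivative G z t) (at t within {t0..})"
      using integral_has_vector_derivative[OF contG'[of "t + 1" z], of t] t
      by (subst at_within_atLeast_eq_atLeastAtMost[of t "t+1"])
         (auto intro!: derivative_eq_intros)
    then have "(x has_vector_derivative G z t) (at t within {t0..})"
      by (rule has_vector_derivative_transform[rotated 2]) (use t in \<open>auto simp: x_eq\<close>)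
    then show "(x has_vector_derivative f t (x t)) (at t within {t0..})"
      by (simp add: G_def x_def)
  qed
qed

section \<open>Monotonicity and convergence on half-lines\<close>

lemma has_real_derivative_interior_atLeast:
  fixes f :: "real \<Rightarrow> real"
  assumes "(f has_real_derivative D) (at t within {t0..})" and "t0 < t"
  shows "(f has_real_derivative D) (at t)"
  using assms at_within_interior[of t "{t0..}"] by simp

lemma nondecreasing_on_atLeast:
  fixes f :: "real \<Rightarrow> real"
  assumes deriv: "\<And>t. t0 \<le> t \<Longrightarrow> (f has_real_derivative f' t) (at t within {t0..})"
    and nonneg: "\<And>t. t0 \<le> t \<Longrightarrow> 0 \<le> f' t"
    and "t0 \<le> s" "s \<le> t"
  shows "f s \<le> f t"
proof (rule DERIV_nonneg_imp_increasing_open[OF \<open>s \<le> t\<close>])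
  fix x assume "s < x" "x < t"
  then show "\<exists>y. (f has_real_derivative y) (at x) \<and> 0 \<le> y"
    using has_real_derivative_interior_atLeast[OF deriv] nonneg \<open>t0 \<le> s\<close>
    by (meson le_less_trans less_imp_le)
next
  have "continuous_on {t0..} f"
    using deriv by (auto intro: DERIV_continuous_on)
  then show "continuous_on {s..t} f"
    by (rule continuous_on_subset) (use \<open>t0 \<le> s\<close> in auto)
qed

text \<open>
  Adding $\pm C/t$ to such a function makes it monotone, which gives both the bound and the limit.
\<close>

lemma inverse_square_derivative:
  fixes P :: "real \<Rightarrow> real"
  assumes t0: "0 < t0"
    and deriv: "\<And>t. t0 \<le> t \<Longrightarrow> (P has_real_derivative R t) (at t within {t0..})"
    and bound: "\<And>t. t0 \<le> t \<Longrightarrow> \<bar>R t\<bar> \<le> C / t\<^sup>2"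
  shows inverse_square_derivative_bound: "\<And>t. t0 \<le> t \<Longrightarrow> \<bar>P t - P t0\<bar> \<le> C / t0"
    and inverse_square_derivative_convergent: "\<exists>L. (P \<longlongrightarrow> L) at_top"
proof -
  have C: "0 \<le> C" using bound[of t0] t0
    by (metis abs_ge_zero divide_le_0_iff dual_order.trans linorder_not_less order.refl
        order_less_imp_le zero_le_divide_iff zero_less_power)
  have d_up: "((\<lambda>t. P t - C / t) has_real_derivative R t + C / t\<^sup>2) (at t within {t0..})"
    and d_down: "((\<lambda>t. - (P t + C / t)) has_real_derivative C / t\<^sup>2 - R t) (at t within {t0..})"
    if "t0 \<le> t" for t
    using that t0 by (auto intro!: derivative_eq_intros deriv simp: power2_eq_square)
  have nn: "0 \<le> R t + C / t\<^sup>2" "0 \<le> C / t\<^sup>2 - R t" if "t0 \<le> t" for t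
    using bound[OF that] by (auto simp: abs_le_iff)
  have up: "P s - C / s \<le> P t - C / t" if "t0 \<le> s" "s \<le> t" for s t
    using nondecreasing_on_atLeast[OF d_up nn(1) that] by simp
  have down: "P t + C / t \<le> P s + C / s" if "t0 \<le> s" "s \<le> t" for s t
    using nondecreasing_on_atLeast[OF d_down nn(2) that] by simp
  show bd: "\<bar>P t - P t0\<bar> \<le> C / t0" if "t0 \<le> t" for t
  proof -
    have "0 \<le> C / t" using C t0 that by simp
    then show ?thesis using up[OF order_refl that] down[OF order_refl that] by linarith
  qed
  define Q where "Q t = P t - C / t" for t
  define l where "l = Sup (Q ` {t0..})"
  have bdd: "bdd_above (Q ` {t0..})"
  proof (rule bdd_aboveI2)
    fix t assume "t \<in> {t0..}"
    then show "Q t \<le> P t0 + C / t0"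
      using bd[of t] C t0 by (auto simp: Q_def abs_le_iff intro: order_trans[of _ "P t"])
  qed
  have "(Q \<longlongrightarrow> l) at_top"
  proof (rule increasing_tendsto)
    show "\<forall>\<^sub>F t in at_top. Q t \<le> l"
      using eventually_ge_at_top[of t0]
      by eventually_elim (auto simp: l_def intro!: cSup_upper bdd)
    fix x assume "x < l"
    then obtain s where s: "t0 \<le> s" "x < Q s"
      unfolding l_def using less_cSup_iff[OF _ bdd] by auto
    show "\<forall>\<^sub>F t in at_top. x < Q t"
      using eventually_ge_at_top[of s]
      by eventually_elim (use s up in \<open>force simp: Q_def\<close>)
  qed
  moreover have "((\<lambda>t. C / t) \<longlongrightarrow> 0) at_top"
    by (rule tendsto_divide_0[OF tendsto_const])
       (simp add: filterlim_at_top_imp_at_infinity filterlim_ident)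
  ultimately have "((\<lambda>t. Q t + C / t) \<longlongrightarrow> l + 0) at_top"
    by (rule tendsto_add)
  then show "\<exists>L. (P \<longlongrightarrow> L) at_top" by (auto simp: Q_def)
qed

section \<open>The family of damped oscillators\<close>

text \<open>
  The oscillators of a whole range of frequencies are solved at once, as one equation whose unknown takes values
  in the bounded continuous functions of the frequency parameter. Continuity in the
  frequency and differentiability in time uniformly in the frequency then come for free.
\<close>

instance bcontfun :: (metric_space, banach) banach ..

definition bcontfun_mult :: "('a::topological_space \<Rightarrow>\<^sub>C real) \<Rightarrow> ('a \<Rightarrow>\<^sub>C real) \<Rightarrow> ('a \<Rightarrow>\<^sub>C real)" where
  "bcontfun_mult f g = Bcontfun (\<lambda>x. f x * g x)"

lemma bcontfun_mult_bound: "norm (apply_bcontfun f x * apply_bcontfun g x) \<le> norm f * norm g"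
  for f g :: "'a::topological_space \<Rightarrow>\<^sub>C real"
  by (metis mult_mono' norm_bounded norm_ge_zero norm_mult)

lemma bcontfun_mult_apply [simp]: "apply_bcontfun (bcontfun_mult f g) x = f x * g x"
proof -
  have "(\<lambda>x. f x * g x) \<in> bcontfun"
    by (rule bcontfun_normI[OF _ bcontfun_mult_bound]) (auto intro!: continuous_intros)
  then show ?thesis by (simp add: bcontfun_mult_def Bcontfun_inverse)
qed

lemma bounded_linear_bcontfun_mult: "bounded_linear (bcontfun_mult f)"
proof (rule bounded_linear_intro)
  show "norm (bcontfun_mult f g) \<le> norm g * norm f" for g
    by (rule norm_bound) (metis bcontfun_mult_apply bcontfun_mult_bound mult.commute)
qed (auto intro!: bcontfun_eqI simp: algebra_simps)

lemma norm_bcontfun_mult: "norm (bcontfun_mult f g) \<le> norm f * norm g"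
  by (rule norm_bound) (metis bcontfun_mult_apply bcontfun_mult_bound)

lemma bounded_linear_apply_bcontfun: "bounded_linear (\<lambda>f. apply_bcontfun f x)"
  for x :: "'a::topological_space"
  by (rule bounded_linear_intro[where K = 1]) (auto simp: norm_bounded)

lemma damped_family_exists:
  fixes b :: "real \<Rightarrow> real" and q U0 U1 :: "'a::metric_space \<Rightarrow>\<^sub>C real"
  assumes cont: "continuous_on {t0..} b"
    and bound: "\<And>t. t0 \<le> t \<Longrightarrow> \<bar>b t\<bar> \<le> \<beta>"
  obtains Y V where "Y t0 = U0" and "V t0 = U1"
    and "\<And>t. t0 \<le> t \<Longrightarrow> (Y has_vector_derivative V t) (at t within {t0..})"
    and "\<And>t. t0 \<le> t \<Longrightarrow> (V has_vector_derivative - b t *\<^sub>R V t - bcontfun_mult q (Y t))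
                            (at t within {t0..})"
proof -
  define f where "f t p = (snd p, - b t *\<^sub>R snd p - bcontfun_mult q (fst p))" for t p
  interpret m: bounded_linear "bcontfun_mult q" by (rule bounded_linear_bcontfun_mult)
  have "continuous_on ({t0..} \<times> UNIV) (\<lambda>p. f (fst p) (snd p))"
    unfolding f_def
    by (intro continuous_intros m.continuous_on continuous_on_compose2[OF cont]) auto
  moreover have "norm (f t x - f t y) \<le> (1 + \<beta> + norm q) * norm (x - y)" if t: "t0 \<le> t" for t x y
  proof -
    define d where "d = x - y"
    have fst_le: "norm (fst d) \<le> norm d" and snd_le: "norm (snd d) \<le> norm d"
      using norm_fst_le[of "fst d" "snd d"] norm_snd_le[of "snd d" "fst d"] by simp_all
    have "f t x - f t y = (snd d, - b t *\<^sub>R snd d - bcontfun_mult q (fst d))"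
      by (simp add: f_def d_def m.diff scaleR_diff_right)
    then have "norm (f t x - f t y) \<le> norm (snd d) + norm (- b t *\<^sub>R snd d - bcontfun_mult q (fst d))"
      by (metis norm_Pair_le)
    also have "\<dots> \<le> norm (snd d) + (norm (- b t *\<^sub>R snd d) + norm (bcontfun_mult q (fst d)))"
      by (intro add_left_mono norm_triangle_ineq4)
    also have "\<dots> \<le> norm d + (\<beta> * norm d + norm q * norm d)"
    proof (intro add_mono)
      show "norm (snd d) \<le> norm d" by (rule snd_le)
      show "norm (- b t *\<^sub>R snd d) \<le> \<beta> * norm d"
        using bound[OF t] snd_le by (auto intro!: mult_mono')
      show "norm (bcontfun_mult q (fst d)) \<le> norm q * norm d"
        using norm_bcontfun_mult[of q "fst d"] fst_le
        by (meson mult_left_mono norm_ge_zero order_trans)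
    qed
    finally show ?thesis by (simp add: d_def algebra_simps)
  qed
  moreover have "norm (f t 0) \<le> 0" for t by (simp add: f_def m.zero)
  ultimately obtain x where x: "x t0 = (U0, U1)"
    "\<And>t. t0 \<le> t \<Longrightarrow> (x has_vector_derivative f t (x t)) (at t within {t0..})"
    using picard_lindelof_global[of t0 f _ 0 "(U0, U1)"] by metis
  show thesis
  proof (rule that[of "\<lambda>t. fst (x t)" "\<lambda>t. snd (x t)"])
    fix t assume t: "t0 \<le> t"
    show "((\<lambda>t. fst (x t)) has_vector_derivative snd (x t)) (at t within {t0..})"
      using bounded_linear.has_vector_derivative[OF bounded_linear_fst x(2)[OF t]]
      by (simp add: f_def)
    show "((\<lambda>t. snd (x t)) has_vector_derivative
            - b t *\<^sub>R snd (x t) - bcontfun_mult q (fst (x t))) (at t within {t0..})"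
      using bounded_linear.has_vector_derivative[OF bounded_linear_snd x(2)[OF t]]
      by (simp add: f_def)
  qed (use x in auto)
qed

lemma damped_family_at_parameter:
  fixes b :: "real \<Rightarrow> real" and q :: "'a::metric_space \<Rightarrow>\<^sub>C real"
  assumes "\<And>t. t0 \<le> t \<Longrightarrow> (Y has_vector_derivative V t) (at t within {t0..})"
    and "\<And>t. t0 \<le> t \<Longrightarrow> (V has_vector_derivative - b t *\<^sub>R V t - bcontfun_mult q (Y t))
                            (at t within {t0..})"
    and "t0 \<le> t"
  shows "((\<lambda>t. Y t x) has_real_derivative V t x) (at t within {t0..})"
    and "((\<lambda>t. V t x) has_real_derivative - b t * V t x - q x * Y t x) (at t within {t0..})"
  using bounded_linear.has_vector_derivative[OF bounded_linear_apply_bcontfun assms(1)[OF assms(3)]]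
    bounded_linear.has_vector_derivative[OF bounded_linear_apply_bcontfun assms(2)[OF assms(3)]]
  by (simp_all add: has_real_derivative_iff_has_vector_derivative)

lemma damped_ode_solution_exists:
  fixes b :: "real \<Rightarrow> real"
  assumes cont: "continuous_on {t0..} b"
    and bound: "\<And>t. t0 \<le> t \<Longrightarrow> \<bar>b t\<bar> \<le> \<beta>"
  shows "\<exists>y. damped_ode_solution t0 b l y0 y1 y"
proof -
  \<comment> \<open>With a constant multiplier all parameters carry the same oscillator; it is read off at $0$.\<close>
  obtain Y V :: "real \<Rightarrow> real \<Rightarrow>\<^sub>C real"
    where YV: "Y t0 = const_bcontfun y0" "V t0 = const_bcontfun y1"
    "\<And>t. t0 \<le> t \<Longrightarrow> (Y has_vector_derivative V t) (at t within {t0..})"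
    "\<And>t. t0 \<le> t \<Longrightarrow> (V has_vector_derivative
        - b t *\<^sub>R V t - bcontfun_mult (const_bcontfun (l\<^sup>2)) (Y t)) (at t within {t0..})"
    using damped_family_exists[OF cont bound] by metis
  show ?thesis
    unfolding damped_ode_solution_def
    using damped_family_at_parameter[OF YV(3,4), where x = 0] YV(1,2)
    by (intro exI[of _ "\<lambda>t. Y t 0"] exI[of _ "\<lambda>t. V t 0"]) auto
qed

text \<open>Damping does not increase the energy of the difference of two solutions.\<close>

lemma damped_ode_unique:
  fixes b :: "real \<Rightarrow> real"
  assumes b: "\<And>t. t0 \<le> t \<Longrightarrow> 0 \<le> b t" and l: "l \<noteq> 0"
    and y: "\<And>t. t0 \<le> t \<Longrightarrow> (y has_real_derivative v t) (at t within {t0..})"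
    and v: "\<And>t. t0 \<le> t \<Longrightarrow> (v has_real_derivative - b t * v t - l\<^sup>2 * y t) (at t within {t0..})"
    and z: "\<And>t. t0 \<le> t \<Longrightarrow> (z has_real_derivative w t) (at t within {t0..})"
    and w: "\<And>t. t0 \<le> t \<Longrightarrow> (w has_real_derivative - b t * w t - l\<^sup>2 * z t) (at t within {t0..})"
    and init: "y t0 = z t0" "v t0 = w t0" and t: "t0 \<le> t"
  shows "y t = z t" and "v t = w t"
proof -
  define e where "e t = - ((v t - w t)\<^sup>2 + l\<^sup>2 * (y t - z t)\<^sup>2)" for t
  have "e t0 \<le> e t"
  proof (rule nondecreasing_on_atLeast[OF _ _ order_refl t])
    fix s assume s: "t0 \<le> s"
    show "(e has_real_derivative 2 * b s * (v s - w s)\<^sup>2) (at s within {t0..})"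
      unfolding e_def
      by (rule derivative_eq_intros y[OF s] v[OF s] z[OF s] w[OF s] refl)+
         (simp add: power2_eq_square algebra_simps)
    show "0 \<le> 2 * b s * (v s - w s)\<^sup>2" using b[OF s] by simp
  qed
  then have "(v t - w t)\<^sup>2 + l\<^sup>2 * (y t - z t)\<^sup>2 \<le> 0"
    by (simp add: e_def init)
  moreover have "0 \<le> (v t - w t)\<^sup>2" "0 \<le> l\<^sup>2 * (y t - z t)\<^sup>2" by auto
  ultimately have "(v t - w t)\<^sup>2 = 0" "l\<^sup>2 * (y t - z t)\<^sup>2 = 0" by linarith+
  then show "y t = z t" "v t = w t" using l by auto
qed

section \<open>Smoothness from a differential algebra\<close>

inductive_set function_algebra :: "('a \<Rightarrow> real) set \<Rightarrow> ('a \<Rightarrow> real) set" for G where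
  generator: "g \<in> G \<Longrightarrow> g \<in> function_algebra G"
| const: "(\<lambda>_. c) \<in> function_algebra G"
| add: "f \<in> function_algebra G \<Longrightarrow> g \<in> function_algebra G \<Longrightarrow> (\<lambda>x. f x + g x) \<in> function_algebra G"
| mult: "f \<in> function_algebra G \<Longrightarrow> g \<in> function_algebra G \<Longrightarrow> (\<lambda>x. f x * g x) \<in> function_algebra G"

lemma function_algebra_derivative:
  assumes gen: "\<And>g. g \<in> G \<Longrightarrow> \<exists>g'\<in>function_algebra G. \<forall>t\<in>S. (g has_real_derivative g' t) (at t within S)"
    and "f \<in> function_algebra G"
  shows "\<exists>f'\<in>function_algebra G. \<forall>t\<in>S. (f has_real_derivative f' t) (at t within S)"
  using assms(2)
proof induction
  case (generator g)
  then show ?case by (rule gen)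
next
  case (const c)
  show ?case by (rule bexI[of _ "\<lambda>_. 0"]) (auto intro: function_algebra.const)
next
  case (add f g)
  then obtain f' g' where "f' \<in> function_algebra G" "g' \<in> function_algebra G"
    "\<forall>t\<in>S. (f has_real_derivative f' t) (at t within S)"
    "\<forall>t\<in>S. (g has_real_derivative g' t) (at t within S)" by auto
  then show ?case
    by (intro bexI[of _ "\<lambda>x. f' x + g' x"])
       (auto intro!: derivative_eq_intros function_algebra.add)
next
  case (mult f g)
  then obtain f' g' where "f' \<in> function_algebra G" "g' \<in> function_algebra G"
    "\<forall>t\<in>S. (f has_real_derivative f' t) (at t within S)"
    "\<forall>t\<in>S. (g has_real_derivative g' t) (at t within S)" by auto
  then show ?case
    using mult.hyps
    by (intro bexI[of _ "\<lambda>x. f' x * g x + g' x * f x"])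
       (auto intro!: derivative_eq_intros function_algebra.add function_algebra.mult)
qed

text \<open>
  Derivatives can be chosen inside the algebra, and the choice can then be iterated. For a solution
  of a differential equation whose right-hand side is built from the generators this yields
  derivatives of all orders at once.
\<close>

lemma C_infinity_on_function_algebra:
  assumes gen: "\<And>g. g \<in> G \<Longrightarrow> \<exists>g'\<in>function_algebra G. \<forall>t\<in>S. (g has_real_derivative g' t) (at t within S)"
    and f: "f \<in> function_algebra G"
  shows "C_infinity_on S f"
proof -
  have "\<forall>f\<in>function_algebra G. \<exists>f'. f' \<in> function_algebra G \<and>
          (\<forall>t\<in>S. (f has_real_derivative f' t) (at t within S))"
    using function_algebra_derivative[OF gen] by auto
  then obtain D where D: "\<And>f. f \<in> function_algebra G \<Longrightarrow> D f \<in> function_algebra G"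
    "\<And>f t. f \<in> function_algebra G \<Longrightarrow> t \<in> S \<Longrightarrow> (f has_real_derivative D f t) (at t within S)"
    by metis
  have "(D ^^ n) f \<in> function_algebra G" for n
    by (induction n) (auto simp: f D)
  then show ?thesis
    unfolding C_infinity_on_def
    by (intro exI[of _ "\<lambda>n. (D ^^ n) f"]) (auto intro: D(2))
qed

section \<open>Resonant damping\<close>

text \<open>
  Integration by parts: $\cos(k\theta)/t$ differs from the derivative of
  $\sin(k\theta)/(k\omega t)$ by a term of order $t^{-2}$.
\<close>

lemma oscillating_integral:
  fixes P \<theta> h :: "real \<Rightarrow> real"
  assumes pos: "0 < t0" "0 < \<omega>" "0 < k"
    and \<theta>: "\<And>t. t0 \<le> t \<Longrightarrow> (\<theta> has_real_derivative \<omega> - h t / t) (at t within {t0..})"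
    and h: "\<And>t. t0 \<le> t \<Longrightarrow> \<bar>h t\<bar> \<le> c"
    and P: "\<And>t. t0 \<le> t \<Longrightarrow> (P has_real_derivative cos (k * \<theta> t) / t) (at t within {t0..})"
  shows oscillating_integral_convergent: "\<exists>L. (P \<longlongrightarrow> L) at_top"
    and oscillating_integral_bounded: "\<exists>B. \<forall>t\<ge>t0. \<bar>P t - P t0\<bar> \<le> B"
proof -
  define G where "G t = sin (k * \<theta> t) / (k * \<omega> * t)" for t
  define C where "C = c / \<omega> + 1 / (k * \<omega>)"
  define R where "R t = (cos (k * \<theta> t) * h t / \<omega> + sin (k * \<theta> t) / (k * \<omega>)) / t\<^sup>2" for t
  have deriv: "((\<lambda>t. P t - G t) has_real_derivative R t) (at t within {t0..})" if t: "t0 \<le> t" for t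
  proof -
    have "((\<lambda>t. P t - G t) has_real_derivative
            cos (k * \<theta> t) / t -
            (cos (k * \<theta> t) * (k * (\<omega> - h t / t)) * (k * \<omega> * t) - sin (k * \<theta> t) * (k * \<omega>)) / (k * \<omega> * t)\<^sup>2)
          (at t within {t0..})"
      unfolding G_def power2_eq_square
      by (rule derivative_eq_intros P[OF t] \<theta>[OF t] refl)+ (use pos t in auto)
    also have "cos (k * \<theta> t) / t -
            (cos (k * \<theta> t) * (k * (\<omega> - h t / t)) * (k * \<omega> * t) - sin (k * \<theta> t) * (k * \<omega>)) / (k * \<omega> * t)\<^sup>2
          = R t"
      unfolding R_def using pos t by (simp add: power2_eq_square divide_simps) (simp add: algebra_simps)
    finally show ?thesis .
  qed
  have bound: "\<bar>R t\<bar> \<le> C / t\<^sup>2" if t: "t0 \<le> t" for t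
  proof -
    have "\<bar>cos (k * \<theta> t)\<bar> * \<bar>h t\<bar> \<le> 1 * c"
      using h[OF t] by (intro mult_mono) auto
    then have "\<bar>cos (k * \<theta> t) * h t / \<omega>\<bar> \<le> c / \<omega>"
      using pos by (simp add: abs_mult divide_right_mono)
    moreover have "\<bar>sin (k * \<theta> t) / (k * \<omega>)\<bar> \<le> 1 / (k * \<omega>)"
      using pos by (simp add: abs_mult divide_right_mono)
    ultimately have "\<bar>cos (k * \<theta> t) * h t / \<omega> + sin (k * \<theta> t) / (k * \<omega>)\<bar> \<le> C"
      unfolding C_def by linarith
    then show ?thesis
      unfolding R_def abs_divide by (simp add: divide_right_mono)
  qed
  have G_bound: "\<bar>G t\<bar> \<le> 1 / (k * \<omega>) / t" if "t0 \<le> t" for t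
    unfolding G_def using pos that by (simp add: abs_mult divide_right_mono)
  have "(G \<longlongrightarrow> 0) at_top"
  proof (rule Lim_null_comparison)
    show "\<forall>\<^sub>F t in at_top. norm (G t) \<le> 1 / (k * \<omega>) / t"
      using eventually_ge_at_top[of t0] by eventually_elim (use G_bound in auto)
    show "((\<lambda>t. 1 / (k * \<omega>) / t) \<longlongrightarrow> 0) at_top"
      by (rule tendsto_divide_0[OF tendsto_const])
         (simp add: filterlim_at_top_imp_at_infinity filterlim_ident)
  qed
  moreover obtain L where "((\<lambda>t. P t - G t) \<longlongrightarrow> L) at_top"
    using inverse_square_derivative_convergent[OF pos(1) deriv bound] by auto
  ultimately have "((\<lambda>t. (P t - G t) + G t) \<longlongrightarrow> L + 0) at_top"
    by (intro tendsto_add)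
  then show "\<exists>L. (P \<longlongrightarrow> L) at_top" by auto
  show "\<exists>B. \<forall>t\<ge>t0. \<bar>P t - P t0\<bar> \<le> B"
  proof (intro exI allI impI)
    fix t assume t: "t0 \<le> t"
    have "1 / (k * \<omega>) / t \<le> 1 / (k * \<omega>) / t0"
      using pos t by (intro divide_left_mono) auto
    then show "\<bar>P t - P t0\<bar> \<le> C / t0 + 2 * (1 / (k * \<omega>) / t0)"
      using inverse_square_derivative_bound[OF pos(1) deriv bound t] G_bound[OF t] G_bound[of t0]
      by linarith
  qed
qed

text \<open>
  This is the phase equation of an oscillator of frequency $\omega$ whose damping coefficient is
  itself a function of the phase. The right-hand side is Lipschitz in the phase uniformly in time.
\<close>

lemma resonant_phase_exists:
  fixes a r t0 \<omega> :: real
  assumes t0: "0 < t0" and ar: "0 \<le> a" "0 \<le> r"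
  obtains \<theta> where "\<theta> t0 = 0"
    and "\<And>t. t0 \<le> t \<Longrightarrow> (\<theta> has_real_derivative
           \<omega> - (a + r * cos (2 * \<theta> t)) * sin (2 * \<theta> t) / 2 / t) (at t within {t0..})"
proof -
  define h where "h x = (a + r * cos (2 * x)) * sin (2 * x) / 2" for x
  define f where "f t x = \<omega> - h x / t" for t x
  have h_deriv: "(h has_real_derivative a * cos (2 * x) + r * cos (4 * x)) (at x)" for x
  proof -
    have "cos (4 * x) = (cos (2 * x))\<^sup>2 - (sin (2 * x))\<^sup>2"
      using cos_double[of "2 * x"] by simp
    then show ?thesis
      unfolding h_def \<open>cos (4 * x) = _\<close>
      by (auto intro!: derivative_eq_intros simp: power2_eq_square field_simps)
  qed
  have h_lip: "\<bar>h x - h y\<bar> \<le> (a + r) * \<bar>x - y\<bar>" for x y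
  proof -
    have "norm (a * cos (2 * z) + r * cos (4 * z)) \<le> a + r" for z
    proof -
      have "\<bar>a * cos (2 * z)\<bar> \<le> a" "\<bar>r * cos (4 * z)\<bar> \<le> r"
        using ar by (auto simp: abs_mult mult_left_le)
      then show ?thesis by simp
    qed
    then show ?thesis
      using field_differentiable_bound[of UNIV h "\<lambda>z. a * cos (2 * z) + r * cos (4 * z)" "a + r" x y]
        h_deriv by simp
  qed
  have "continuous_on ({t0..} \<times> UNIV) (\<lambda>p. f (fst p) (snd p))"
    unfolding f_def h_def using t0 by (auto intro!: continuous_intros)
  moreover have "norm (f t x - f t y) \<le> (a + r) / t0 * norm (x - y)" if t: "t0 \<le> t" for t x y
  proof -
    have "norm (f t x - f t y) = \<bar>h x - h y\<bar> / t"
      using t t0 by (simp add: f_def abs_minus_commute flip: diff_divide_distrib)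
    also have "\<dots> \<le> (a + r) * \<bar>x - y\<bar> / t0"
      using h_lip[of x y] t t0 ar by (intro frac_le) auto
    finally show ?thesis by simp
  qed
  moreover have "norm (f t 0) \<le> \<bar>\<omega>\<bar>" for t by (simp add: f_def h_def)
  ultimately obtain \<theta> where "\<theta> t0 = 0"
    "\<And>t. t0 \<le> t \<Longrightarrow> (\<theta> has_vector_derivative f t (\<theta> t)) (at t within {t0..})"
    using picard_lindelof_global[of t0 f _ "\<bar>\<omega>\<bar>" 0] by metis
  then show thesis
    using that by (simp add: f_def h_def has_real_derivative_iff_has_vector_derivative)
qed

lemma integral_from_has_real_derivative:
  fixes g :: "real \<Rightarrow> real"
  assumes "continuous_on {t0..} g" and "t0 \<le> t"
  shows "((\<lambda>t. integral {t0..t} g) has_real_derivative g t) (at t within {t0..})"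
proof -
  have "continuous_on {t0..t + 1} g"
    by (rule continuous_on_subset[OF assms(1)]) auto
  then show ?thesis
    using integral_has_vector_derivative[of t0 "t + 1" g t] assms(2)
    by (subst at_within_atLeast_eq_atLeastAtMost[of t "t + 1"])
       (auto simp: has_real_derivative_iff_has_vector_derivative)
qed

text \<open>
  With $b=(a+r\cos 2\theta)/t$ and $\theta$ the resonant phase, the pair
  $(\varrho\cos\theta,-\omega\varrho\sin\theta)$ is a solution as soon as
  $\varrho'/\varrho=-b\sin^2\theta$. In
  \[2tb\sin^2\theta=(a+r\cos2\theta)(1-\cos2\theta)
     =a-\tfrac r2+(r-a)\cos2\theta-\tfrac r2\cos4\theta\]
  the two oscillating terms contribute a bounded amount to $\log\varrho$, so $\varrho^2$ is comparable
  to $t^{-(a-r/2)}$: the resonance between $b$ and the kinetic energy saves half of the amplitude $r$.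
\<close>

proposition resonant_damping:
  fixes a r t0 \<omega> :: real
  assumes t0: "0 < t0" and \<omega>: "0 < \<omega>" and r: "0 < r" "r \<le> a"
  obtains b y v :: "real \<Rightarrow> real" and c :: real where
    "C_infinity_on {t0..} b"
    and "\<And>t. t0 \<le> t \<Longrightarrow> (a - r) / t \<le> b t \<and> b t \<le> (a + r) / t"
    and "\<exists>L. ((\<lambda>t. (t0 / t) powr a * exp (integral {t0..t} b)) \<longlongrightarrow> L) at_top"
    and "y t0 = 1" and "v t0 = 0"
    and "\<And>t. t0 \<le> t \<Longrightarrow> (y has_real_derivative v t) (at t within {t0..})"
    and "\<And>t. t0 \<le> t \<Longrightarrow> (v has_real_derivative - b t * v t - \<omega>\<^sup>2 * y t) (at t within {t0..})"
    and "0 < c" and "\<And>t. t0 \<le> t \<Longrightarrow> c / t powr (a - r / 2) \<le> (v t)\<^sup>2 + \<omega>\<^sup>2 * (y t)\<^sup>2"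
proof -
  have ar: "0 \<le> a" "0 \<le> r" using r by auto
  obtain \<theta> where \<theta>0: "\<theta> t0 = 0"
    and \<theta>: "\<And>t. t0 \<le> t \<Longrightarrow> (\<theta> has_real_derivative
           \<omega> - (a + r * cos (2 * \<theta> t)) * sin (2 * \<theta> t) / 2 / t) (at t within {t0..})"
    using resonant_phase_exists[OF t0 ar, of \<omega>] by blast
  define b where "b t = (a + r * cos (2 * \<theta> t)) / t" for t
  have cont_\<theta>: "continuous_on {t0..} \<theta>"
    by (rule DERIV_continuous_on, rule \<theta>) simp
  have cont_b: "continuous_on {t0..} b"
    unfolding b_def using t0 by (auto intro!: continuous_intros cont_\<theta>)
  define G where "G = {\<lambda>t. 1 / t, \<lambda>t. cos (2 * \<theta> t), \<lambda>t. sin (2 * \<theta> t)}"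
  note alg = function_algebra.add function_algebra.mult function_algebra.const
  have gens: "(\<lambda>t. 1 / t) \<in> function_algebra G" "(\<lambda>t. cos (2 * \<theta> t)) \<in> function_algebra G"
    "(\<lambda>t. sin (2 * \<theta> t)) \<in> function_algebra G"
    by (auto simp: G_def intro: function_algebra.generator)
  have smooth: "C_infinity_on {t0..} b"
  proof (rule C_infinity_on_function_algebra)
    have "(\<lambda>t. (a + r * cos (2 * \<theta> t)) * (1 / t)) \<in> function_algebra G"
      by (intro alg gens)
    then show "b \<in> function_algebra G" by (simp add: b_def[abs_def])
    let ?\<theta>' = "\<lambda>t. \<omega> + (-1/2) * ((a + r * cos (2 * \<theta> t)) * (sin (2 * \<theta> t) * (1 / t)))"
    have \<theta>': "(\<theta> has_real_derivative ?\<theta>' t) (at t within {t0..})" if "t0 \<le> t" for t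
      using \<theta>[OF that] by simp
    fix g assume "g \<in> G"
    then consider "g = (\<lambda>t. 1 / t)" | "g = (\<lambda>t. cos (2 * \<theta> t))" | "g = (\<lambda>t. sin (2 * \<theta> t))"
      by (auto simp: G_def)
    then show "\<exists>g'\<in>function_algebra G. \<forall>t\<in>{t0..}. (g has_real_derivative g' t) (at t within {t0..})"
    proof cases
      case 1
      show ?thesis
        unfolding 1 using t0
        by (intro bexI[of _ "\<lambda>t. (-1) * ((1 / t) * (1 / t))"] alg gens)
           (auto intro!: derivative_eq_intros)
    next
      case 2
      show ?thesis
        unfolding 2
        by (intro bexI[of _ "\<lambda>t. (-2) * (sin (2 * \<theta> t) * ?\<theta>' t)"] alg gens ballI)
           (rule derivative_eq_intros \<theta>' refl | simp)+
    next
      case 3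
      show ?thesis
        unfolding 3
        by (intro bexI[of _ "\<lambda>t. 2 * (cos (2 * \<theta> t) * ?\<theta>' t)"] alg gens ballI)
           (rule derivative_eq_intros \<theta>' refl | simp)+
    qed
  qed
  have bounds: "(a - r) / t \<le> b t \<and> b t \<le> (a + r) / t" if "t0 \<le> t" for t
  proof -
    have "\<bar>r * cos (2 * \<theta> t)\<bar> \<le> r" using r by (simp add: abs_mult mult_left_le)
    then show ?thesis
      unfolding b_def using t0 that by (intro conjI divide_right_mono) auto
  qed
  define I where "I k t = integral {t0..t} (\<lambda>s. cos (k * \<theta> s) / s)" for k t
  have I: "(I k has_real_derivative cos (k * \<theta> t) / t) (at t within {t0..})" if "t0 \<le> t" for k t
    unfolding I_def
    by (rule integral_from_has_real_derivative[OF _ that])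
       (use t0 in \<open>auto intro!: continuous_intros cont_\<theta>\<close>)
  have I0: "I k t0 = 0" for k by (simp add: I_def)
  have h_bound: "\<bar>(a + r * cos (2 * \<theta> t)) * sin (2 * \<theta> t) / 2\<bar> \<le> a + r" for t
  proof -
    have "\<bar>r * cos (2 * \<theta> t)\<bar> \<le> r" using r by (simp add: abs_mult mult_left_le)
    then have "\<bar>a + r * cos (2 * \<theta> t)\<bar> * \<bar>sin (2 * \<theta> t)\<bar> \<le> (a + r) * 1"
      using r by (intro mult_mono) auto
    then show ?thesis using r by (simp add: abs_mult)
  qed
  note osc = oscillating_integral[OF t0 \<omega> _ \<theta> h_bound I]
  obtain B2 where B2: "\<And>t. t0 \<le> t \<Longrightarrow> \<bar>I 2 t\<bar> \<le> B2"
    using osc(2)[of 2] by (auto simp: I0)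
  obtain B4 where B4: "\<And>t. t0 \<le> t \<Longrightarrow> \<bar>I 4 t\<bar> \<le> B4"
    using osc(2)[of 4] by (auto simp: I0)
  have int_b: "integral {t0..t} b = a * ln (t / t0) + r * I 2 t" if t: "t0 \<le> t" for t
  proof -
    have "(b has_integral (a * ln (t / t0) + r * I 2 t) - (a * ln (t0 / t0) + r * I 2 t0)) {t0..t}"
    proof (rule fundamental_theorem_of_calculus[OF t])
      fix s assume s: "s \<in> {t0..t}"
      have "((\<lambda>t. a * ln (t / t0) + r * I 2 t) has_real_derivative b s) (at s within {t0..})"
        unfolding b_def using s t0
        by (auto intro!: derivative_eq_intros I simp: field_simps)
      then show "((\<lambda>t. a * ln (t / t0) + r * I 2 t) has_vector_derivative b s) (at s within {t0..t})"
        unfolding has_real_derivative_iff_has_vector_derivative[symmetric]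
        by (rule DERIV_subset) auto
    qed
    then show ?thesis using t0 by (simp add: I0 integral_unique)
  qed
  have limit: "\<exists>L. ((\<lambda>t. (t0 / t) powr a * exp (integral {t0..t} b)) \<longlongrightarrow> L) at_top"
  proof -
    obtain L where "(I 2 \<longlongrightarrow> L) at_top" using osc(1)[of 2] by auto
    then have "((\<lambda>t. exp (r * I 2 t)) \<longlongrightarrow> exp (r * L)) at_top"
      by (intro tendsto_intros)
    moreover have "\<forall>\<^sub>F t in at_top. exp (r * I 2 t) = (t0 / t) powr a * exp (integral {t0..t} b)"
      using eventually_ge_at_top[of t0]
    proof eventually_elim
      case (elim t)
      then show ?case
        using t0 by (simp add: int_b powr_def ln_div exp_add[symmetric] algebra_simps)
    qed
    ultimately show ?thesis by (intro exI[of _ "exp (r * L)"]) (rule Lim_transform_eventually)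
  qed
  define p where "p = a - r / 2"
  define \<rho> where "\<rho> t = exp (- (p * ln (t / t0) + (r - a) * I 2 t - r / 2 * I 4 t) / 2)" for t
  have \<rho>: "(\<rho> has_real_derivative - b t * (sin (\<theta> t))\<^sup>2 * \<rho> t) (at t within {t0..})"
    if t: "t0 \<le> t" for t
  proof -
    have c4: "cos (4 * \<theta> t) = 2 * (cos (2 * \<theta> t))\<^sup>2 - 1"
      using cos_double_cos[of "2 * \<theta> t"] by simp
    have s2: "(sin (\<theta> t))\<^sup>2 = (1 - cos (2 * \<theta> t)) / 2"
      by (simp add: cos_double_sin)
    have t_pos: "0 < t" using t t0 by simp
    have "(\<rho> has_real_derivative \<rho> t *
            (- (p * (1 / t) + (r - a) * (cos (2 * \<theta> t) / t) - r / 2 * (cos (4 * \<theta> t) / t)) / 2))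
          (at t within {t0..})"
      unfolding \<rho>_def using t_pos t0 by (auto intro!: derivative_eq_intros I[OF t])
    also have "- (p * (1 / t) + (r - a) * (cos (2 * \<theta> t) / t) - r / 2 * (cos (4 * \<theta> t) / t)) / 2
                = - b t * (sin (\<theta> t))\<^sup>2"
      unfolding b_def c4 s2 p_def using t_pos by (simp add: field_simps power2_eq_square)
    finally show ?thesis by (simp add: mult_ac)
  qed
  have \<theta>b: "(\<theta> has_real_derivative \<omega> - b t * (sin (\<theta> t) * cos (\<theta> t))) (at t within {t0..})"
    if t: "t0 \<le> t" for t
    using \<theta>[OF t] unfolding b_def sin_double by (simp add: mult_ac)
  define y where "y t = \<rho> t * cos (\<theta> t)" for t
  define v where "v t = - \<omega> * (\<rho> t * sin (\<theta> t))" for t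
  have y: "(y has_real_derivative v t) (at t within {t0..})" if t: "t0 \<le> t" for t
    unfolding y_def v_def
    by (rule derivative_eq_intros \<rho>[OF t] \<theta>b[OF t] refl)+
       (simp add: power2_eq_square algebra_simps)
  have v: "(v has_real_derivative - b t * v t - \<omega>\<^sup>2 * y t) (at t within {t0..})" if t: "t0 \<le> t" for t
  proof -
    have "(v has_real_derivative - \<omega> * (- b t * (sin (\<theta> t))\<^sup>2 * \<rho> t * sin (\<theta> t)
            + cos (\<theta> t) * (\<omega> - b t * (sin (\<theta> t) * cos (\<theta> t))) * \<rho> t)) (at t within {t0..})"
      unfolding v_def
      by (rule derivative_eq_intros \<rho>[OF t] \<theta>b[OF t] refl)+ simp
    also have "- \<omega> * (- b t * (sin (\<theta> t))\<^sup>2 * \<rho> t * sin (\<theta> t)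
            + cos (\<theta> t) * (\<omega> - b t * (sin (\<theta> t) * cos (\<theta> t))) * \<rho> t)
          = \<omega> * \<rho> t * b t * sin (\<theta> t) * ((sin (\<theta> t))\<^sup>2 + (cos (\<theta> t))\<^sup>2) - \<omega>\<^sup>2 * (\<rho> t * cos (\<theta> t))"
      by algebra
    also have "\<dots> = - b t * v t - \<omega>\<^sup>2 * y t"
      by (simp add: v_def y_def)
    finally show ?thesis .
  qed
  define c where "c = \<omega>\<^sup>2 * t0 powr p * exp (- ((a - r) * B2 + r / 2 * B4))"
  have "c / t powr p \<le> (v t)\<^sup>2 + \<omega>\<^sup>2 * (y t)\<^sup>2" if t: "t0 \<le> t" for t
  proof -
    have "0 < t" using t t0 by simp
    have "(v t)\<^sup>2 + \<omega>\<^sup>2 * (y t)\<^sup>2 = \<omega>\<^sup>2 * (\<rho> t)\<^sup>2 * ((sin (\<theta> t))\<^sup>2 + (cos (\<theta> t))\<^sup>2)"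
      unfolding v_def y_def by algebra
    also have "\<dots> = \<omega>\<^sup>2 * (\<rho> t)\<^sup>2" by simp
    also have "(\<rho> t)\<^sup>2 = exp (- (p * ln (t / t0)) + ((a - r) * I 2 t + r / 2 * I 4 t))"
      unfolding \<rho>_def exp_double[symmetric] by (simp add: field_simps)
    also have "\<dots> = t0 powr p / t powr p * exp ((a - r) * I 2 t + r / 2 * I 4 t)"
      using t0 \<open>0 < t\<close>
      by (simp add: powr_def ln_div mult_exp_exp exp_diff[symmetric] algebra_simps)
    finally have eq: "(v t)\<^sup>2 + \<omega>\<^sup>2 * (y t)\<^sup>2
        = \<omega>\<^sup>2 * (t0 powr p / t powr p * exp ((a - r) * I 2 t + r / 2 * I 4 t))" .
    have "- B2 \<le> I 2 t" "- B4 \<le> I 4 t"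
      using B2[OF t] B4[OF t] by (auto simp: abs_le_iff)
    then have "(a - r) * (- B2) \<le> (a - r) * I 2 t" "r / 2 * (- B4) \<le> r / 2 * I 4 t"
      using r by (auto simp only: intro!: mult_left_mono)
    then have "exp (- ((a - r) * B2 + r / 2 * B4)) \<le> exp ((a - r) * I 2 t + r / 2 * I 4 t)"
      by (simp add: algebra_simps)
    then have "\<omega>\<^sup>2 * (t0 powr p / t powr p * exp (- ((a - r) * B2 + r / 2 * B4)))
        \<le> (v t)\<^sup>2 + \<omega>\<^sup>2 * (y t)\<^sup>2"
      unfolding eq by (intro mult_left_mono) auto
    then show ?thesis by (simp add: c_def mult_ac)
  qed
  moreover have "0 < c" using \<omega> t0 by (simp add: c_def)
  moreover have "y t0 = 1" "v t0 = 0"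
    using t0 by (simp_all add: y_def v_def \<rho>_def \<theta>0 I0)
  ultimately show thesis
    using that[of b y v c] smooth bounds limit y v unfolding p_def by blast
qed

section \<open>Calculus of the unitary equivalence\<close>

lemma L2D: "f \<in> L2 M \<Longrightarrow> f \<in> borel_measurable M" "f \<in> L2 M \<Longrightarrow> integrable M (\<lambda>\<xi>. (f \<xi>)\<^sup>2)"
  by (auto simp: L2_def)

lemma L2_dominated:
  assumes "f \<in> L2 M" and [measurable]: "g \<in> borel_measurable M"
    and bound: "\<And>\<xi>. \<xi> \<in> space M \<Longrightarrow> \<bar>g \<xi>\<bar> \<le> C * \<bar>f \<xi>\<bar>"
  shows "g \<in> L2 M"
proof -
  have "integrable M (\<lambda>\<xi>. (g \<xi>)\<^sup>2)"
  proof (rule Bochner_Integration.integrable_bound)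
    show "integrable M (\<lambda>\<xi>. C\<^sup>2 * (f \<xi>)\<^sup>2)" using L2D(2)[OF assms(1)] by simp
    show "AE \<xi> in M. norm ((g \<xi>)\<^sup>2) \<le> norm (C\<^sup>2 * (f \<xi>)\<^sup>2)"
    proof (rule AE_I2)
      fix \<xi> assume "\<xi> \<in> space M"
      then have "\<bar>g \<xi>\<bar>\<^sup>2 \<le> (C * \<bar>f \<xi>\<bar>)\<^sup>2"
        using bound by (intro power_mono) auto
      then show "norm ((g \<xi>)\<^sup>2) \<le> norm (C\<^sup>2 * (f \<xi>)\<^sup>2)"
        by (simp add: power_mult_distrib)
    qed
  qed measurable
  then show ?thesis by (simp add: L2_def)
qed

context
  fixes M :: "'m measure" and F :: "'h::{real_inner,complete_space} \<Rightarrow> 'm \<Rightarrow> real"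
  assumes iso: "L2_isometry M F"
begin

lemma isometry_L2: "F u \<in> L2 M"
  using iso by (auto simp: L2_isometry_def)

lemma isometry_measurable: "F u \<in> borel_measurable M"
  using isometry_L2 by (rule L2D)

lemma isometry_add: "AE \<xi> in M. F (u + v) \<xi> = F u \<xi> + F v \<xi>"
  using iso by (auto simp: L2_isometry_def)

lemma isometry_scale: "AE \<xi> in M. F (c *\<^sub>R u) \<xi> = c * F u \<xi>"
  using iso by (auto simp: L2_isometry_def)

lemma isometry_surj:
  assumes "f \<in> L2 M" obtains u where "AE \<xi> in M. F u \<xi> = f \<xi>"
  using iso assms by (auto simp: L2_isometry_def)

lemma isometry_norm:
  assumes "AE \<xi> in M. F u \<xi> = f \<xi>" and [measurable]: "f \<in> borel_measurable M"
  shows "(norm u)\<^sup>2 = (\<integral>\<xi>. (f \<xi>)\<^sup>2 \<partial>M)"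
proof -
  have "(norm u)\<^sup>2 = (\<integral>\<xi>. (F u \<xi>)\<^sup>2 \<partial>M)"
    using iso by (auto simp: L2_isometry_def)
  also have "\<dots> = (\<integral>\<xi>. (f \<xi>)\<^sup>2 \<partial>M)"
    by (rule integral_cong_AE) (use assms isometry_measurable in auto)
  finally show ?thesis .
qed

lemma isometry_eq_zero:
  assumes "AE \<xi> in M. F u \<xi> = 0" shows "u = 0"
  using isometry_norm[OF assms] by simp

lemma isometry_inj:
  assumes "AE \<xi> in M. F u \<xi> = F v \<xi>" shows "u = v"
proof -
  have "AE \<xi> in M. F (u + (- 1) *\<^sub>R v) \<xi> = 0"
    using assms isometry_add[of u "(- 1) *\<^sub>R v"] isometry_scale[of "- 1" v] by eventually_elim simp
  from isometry_eq_zero[OF this] show ?thesis by simp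
qed

lemma op_power_eqI:
  assumes "AE \<xi> in M. F v \<xi> = lam \<xi> powr (2 * \<beta>) * F u \<xi>"
  shows "op_power M lam F \<beta> u = v"
  unfolding op_power_def
proof (rule the_equality)
  fix w assume "AE \<xi> in M. F w \<xi> = lam \<xi> powr (2 * \<beta>) * F u \<xi>"
  with assms have "AE \<xi> in M. F w \<xi> = F v \<xi>" by eventually_elim simp
  then show "w = v" by (rule isometry_inj)
qed (rule assms)

text \<open>
  A fixed $f\in L^2$ turns a function $g$ of the frequency into the element of the Hilbert space
  represented by $f\cdot(g\circ\lambda)$. Through this map, derivatives taken in the space of
  functions of the frequency become derivatives in the Hilbert space.
\<close>

lemma frequency_multiplier_map:
  assumes f: "f \<in> L2 M" and lam [measurable]: "lam \<in> borel_measurable M"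
  obtains T :: "(real \<Rightarrow>\<^sub>C real) \<Rightarrow> 'h" where "bounded_linear T"
    and "\<And>g. AE \<xi> in M. F (T g) \<xi> = f \<xi> * g (lam \<xi>)"
proof -
  note [measurable] = L2D(1)[OF f]
  have [measurable]: "(\<lambda>\<xi>. apply_bcontfun g (lam \<xi>)) \<in> borel_measurable M" for g :: "real \<Rightarrow>\<^sub>C real"
    by (rule measurable_compose[OF lam]) (intro borel_measurable_continuous_onI continuous_on_apply_bcontfun)
  have ptw: "\<bar>f \<xi> * g (lam \<xi>)\<bar> \<le> norm g * \<bar>f \<xi>\<bar>" for g :: "real \<Rightarrow>\<^sub>C real" and \<xi>
    using norm_bounded[of g "lam \<xi>"] mult_left_mono[of "\<bar>g (lam \<xi>)\<bar>" "norm g" "\<bar>f \<xi>\<bar>"]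
    by (simp add: abs_mult mult.commute)
  have "(\<lambda>\<xi>. f \<xi> * g (lam \<xi>)) \<in> L2 M" for g :: "real \<Rightarrow>\<^sub>C real"
    by (rule L2_dominated[OF f _ ptw]) measurable
  then have ex: "\<exists>u. AE \<xi> in M. F u \<xi> = f \<xi> * g (lam \<xi>)" for g :: "real \<Rightarrow>\<^sub>C real"
    using isometry_surj by metis
  define T where "T g = (SOME u. AE \<xi> in M. F u \<xi> = f \<xi> * g (lam \<xi>))" for g :: "real \<Rightarrow>\<^sub>C real"
  have T: "AE \<xi> in M. F (T g) \<xi> = f \<xi> * g (lam \<xi>)" for g :: "real \<Rightarrow>\<^sub>C real"
    unfolding T_def by (rule someI_ex[OF ex])
  have "bounded_linear T"
  proof (rule bounded_linear_intro)
    fix g h :: "real \<Rightarrow>\<^sub>C real" and c :: real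
    have "AE \<xi> in M. F (T (g + h)) \<xi> = F (T g + T h) \<xi>"
      using T[of g] T[of h] T[of "g + h"] isometry_add[of "T g" "T h"]
      by eventually_elim (simp add: algebra_simps)
    then show "T (g + h) = T g + T h" by (rule isometry_inj)
    have "AE \<xi> in M. F (T (c *\<^sub>R g)) \<xi> = F (c *\<^sub>R T g) \<xi>"
      using T[of g] T[of "c *\<^sub>R g"] isometry_scale[of c "T g"]
      by eventually_elim (simp add: algebra_simps)
    then show "T (c *\<^sub>R g) = c *\<^sub>R T g" by (rule isometry_inj)
    have "(norm (T g))\<^sup>2 = (\<integral>\<xi>. (f \<xi> * g (lam \<xi>))\<^sup>2 \<partial>M)"
      by (rule isometry_norm[OF T]) measurable
    also have "\<dots> \<le> (\<integral>\<xi>. (norm g)\<^sup>2 * (f \<xi>)\<^sup>2 \<partial>M)"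
    proof (rule integral_mono')
      show "integrable M (\<lambda>\<xi>. (norm g)\<^sup>2 * (f \<xi>)\<^sup>2)" using L2D(2)[OF f] by simp
      fix \<xi>
      have "\<bar>f \<xi> * g (lam \<xi>)\<bar>\<^sup>2 \<le> (norm g * \<bar>f \<xi>\<bar>)\<^sup>2"
        using ptw by (intro power_mono) auto
      then show "(f \<xi> * g (lam \<xi>))\<^sup>2 \<le> (norm g)\<^sup>2 * (f \<xi>)\<^sup>2"
        by (simp add: power_mult_distrib)
    qed auto
    also have "\<dots> = (norm g * sqrt (\<integral>\<xi>. (f \<xi>)\<^sup>2 \<partial>M))\<^sup>2"
      by (simp add: power_mult_distrib)
    finally show "norm (T g) \<le> norm g * sqrt (\<integral>\<xi>. (f \<xi>)\<^sup>2 \<partial>M)"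
      by (rule power2_le_imp_le) simp
  qed
  then show thesis using T that by blast
qed

end

section \<open>Data concentrated near a frequency of the operator\<close>

text \<open>
  If there were no such $\omega$, every positive frequency would have a neighbourhood
  that $Fu$ does not charge;
  countably many of them cover the positive frequencies, hence $\lambda^2 Fu$ would vanish
  almost everywhere.
\<close>

lemma positive_frequency_exists:
  assumes eq: "equivalent_to_multiplication D A M lam F" and "u \<in> D" "A u \<noteq> 0"
  obtains \<omega> where "0 < \<omega>" and "\<And>\<delta>. 0 < \<delta> \<Longrightarrow> \<not> (AE \<xi> in M. \<bar>lam \<xi> - \<omega>\<bar> < \<delta> \<longrightarrow> F u \<xi> = 0)"
proof -
  have iso: "L2_isometry M F" and lam0: "\<And>\<xi>. \<xi> \<in> space M \<Longrightarrow> 0 \<le> lam \<xi>"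
    and Au: "AE \<xi> in M. F (A u) \<xi> = (lam \<xi>)\<^sup>2 * F u \<xi>"
    using eq \<open>u \<in> D\<close> by (auto simp: equivalent_to_multiplication_def)
  have "\<exists>\<omega>>0. \<forall>\<delta>>0. \<not> (AE \<xi> in M. \<bar>lam \<xi> - \<omega>\<bar> < \<delta> \<longrightarrow> F u \<xi> = 0)"
  proof (rule ccontr)
    assume "\<not> ?thesis"
    then obtain d where d: "\<And>\<omega>. 0 < \<omega> \<Longrightarrow> 0 < d \<omega>"
      "\<And>\<omega>. 0 < \<omega> \<Longrightarrow> AE \<xi> in M. \<bar>lam \<xi> - \<omega>\<bar> < d \<omega> \<longrightarrow> F u \<xi> = 0"
      by metis
    obtain \<B> where \<B>: "\<B> \<subseteq> (\<lambda>\<omega>. ball \<omega> (d \<omega>)) ` {0<..}" "countable \<B>"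
      "\<Union>\<B> = \<Union>((\<lambda>\<omega>. ball \<omega> (d \<omega>)) ` {0<..})"
      by (rule Lindelof[of "(\<lambda>\<omega>. ball \<omega> (d \<omega>)) ` {0<..}"]) auto
    have "AE \<xi> in M. \<forall>B\<in>\<B>. lam \<xi> \<in> B \<longrightarrow> F u \<xi> = 0"
    proof (rule AE_ball_countable'[OF _ \<B>(2)])
      fix B assume "B \<in> \<B>"
      then obtain \<omega> where "0 < \<omega>" "B = ball \<omega> (d \<omega>)" using \<B>(1) by auto
      then show "AE \<xi> in M. lam \<xi> \<in> B \<longrightarrow> F u \<xi> = 0"
        using d(2)[of \<omega>] by (simp add: dist_real_def abs_minus_commute)
    qed
    moreover have "\<exists>B\<in>\<B>. l \<in> B" if "0 < l" for l
    proof -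
      have "l \<in> \<Union>((\<lambda>\<omega>. ball \<omega> (d \<omega>)) ` {0<..})" using that d(1)[of l] centre_in_ball by blast
      then show ?thesis using \<B>(3) by blast
    qed
    ultimately have "AE \<xi> in M. 0 < lam \<xi> \<longrightarrow> F u \<xi> = 0"
      by (auto elim: eventually_mono)
    with Au AE_space have "AE \<xi> in M. F (A u) \<xi> = 0"
      by eventually_elim (use lam0 in force)
    then have "A u = 0" by (rule isometry_eq_zero[OF iso])
    with \<open>A u \<noteq> 0\<close> show False ..
  qed
  then show thesis using that by blast
qed

lemma concentrated_function_exists:
  fixes lam g :: "'m \<Rightarrow> real" and \<omega> \<delta> c :: real
  assumes g: "g \<in> L2 M" and [measurable]: "lam \<in> borel_measurable M"
    and charge: "\<not> (AE \<xi> in M. \<bar>lam \<xi> - \<omega>\<bar> < \<delta> \<longrightarrow> g \<xi> = 0)" and "0 \<le> c"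
  obtains f where "f \<in> L2 M" and "(\<integral>\<xi>. (f \<xi>)\<^sup>2 \<partial>M) = c"
    and "\<And>\<xi>. f \<xi> \<noteq> 0 \<Longrightarrow> \<bar>lam \<xi> - \<omega>\<bar> < \<delta>"
proof -
  note [measurable] = L2D(1)[OF g]
  define f where "f \<xi> = (if \<bar>lam \<xi> - \<omega>\<bar> < \<delta> then g \<xi> else 0)" for \<xi>
  define N where "N = (\<integral>\<xi>. (f \<xi>)\<^sup>2 \<partial>M)"
  have meas [measurable]: "f \<in> borel_measurable M" unfolding f_def abs_less_iff by measurable
  have f: "f \<in> L2 M"
    by (rule L2_dominated[OF g meas, of 1]) (auto simp: f_def)
  have "N \<noteq> 0"
  proof
    assume "N = 0"
    then have "AE \<xi> in M. (f \<xi>)\<^sup>2 = 0"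
      unfolding N_def using integral_nonneg_eq_0_iff_AE[OF L2D(2)[OF f]] by simp
    then have "AE \<xi> in M. \<bar>lam \<xi> - \<omega>\<bar> < \<delta> \<longrightarrow> g \<xi> = 0"
      by eventually_elim (auto simp: f_def)
    with charge show False ..
  qed
  moreover have "0 \<le> N" unfolding N_def by (rule Bochner_Integration.integral_nonneg) auto
  ultimately have N: "0 < N" by simp
  show thesis
  proof (rule that[of "\<lambda>\<xi>. sqrt (c / N) * f \<xi>"])
    show "(\<lambda>\<xi>. sqrt (c / N) * f \<xi>) \<in> L2 M"
      by (rule L2_dominated[OF f, of _ "sqrt (c / N)"])
         (use N \<open>0 \<le> c\<close> in \<open>auto simp: abs_mult\<close>)
    show "(\<integral>\<xi>. (sqrt (c / N) * f \<xi>)\<^sup>2 \<partial>M) = c"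
      using N \<open>0 \<le> c\<close> by (simp add: power_mult_distrib N_def[symmetric])
  qed (auto simp: f_def split: if_splits)
qed

section \<open>Lower bound for the maximal energy\<close>

text \<open>
  The data $(f,0)$ with $f$ concentrated in frequency within $\delta$ of $\omega$ evolve as
  superpositions of oscillators that, at the given time, are close to the one of
  frequency $\omega$. Since the supremum is taken separately at each time, $\delta$ may depend on
  $t$, so continuity of the oscillators in the frequency at that time is all that the argument
  uses, whether the spectrum is discrete or continuous. Both energy terms are kept because near the
  turning points of the oscillator one of them vanishes.
\<close>

lemma max_energy_ge_frequency_energy:
  fixes D :: "'h::{real_inner,complete_space} set" and lam :: "'m \<Rightarrow> real"
    and b y v :: "real \<Rightarrow> real"
  assumes eq: "equivalent_to_multiplication D A M lam F" and \<omega>: "0 < \<omega>"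
    and charge: "\<And>\<delta>. 0 < \<delta> \<Longrightarrow> \<not> (AE \<xi> in M. \<bar>lam \<xi> - \<omega>\<bar> < \<delta> \<longrightarrow> F p \<xi> = 0)"
    and b: "continuous_on {t0..} b" "\<And>t. t0 \<le> t \<Longrightarrow> 0 \<le> b t" "\<And>t. t0 \<le> t \<Longrightarrow> b t \<le> \<beta>"
    and y: "\<And>t. t0 \<le> t \<Longrightarrow> (y has_real_derivative v t) (at t within {t0..})"
    and v: "\<And>t. t0 \<le> t \<Longrightarrow> (v has_real_derivative - b t * v t - \<omega>\<^sup>2 * y t) (at t within {t0..})"
    and init: "y t0 = 1" "v t0 = 0"
    and t: "t0 \<le> t" and pos: "0 < (v t)\<^sup>2 + \<omega>\<^sup>2 * (y t)\<^sup>2"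
  shows "ereal (((v t)\<^sup>2 + \<omega>\<^sup>2 * (y t)\<^sup>2) / (2 * ((\<omega> + 1)\<^sup>2 + 1))) \<le> max_energy M lam F t0 b t"
proof -
  have iso: "L2_isometry M F" and lam [measurable]: "lam \<in> borel_measurable M"
    and lam0: "\<And>\<xi>. \<xi> \<in> space M \<Longrightarrow> 0 \<le> lam \<xi>"
    using eq by (auto simp: equivalent_to_multiplication_def)
  note isometry_measurable[OF iso, measurable]
  \<comment> \<open>The multiplier $l^2$ is unbounded. Only frequencies up to $\omega+1$ carry data, so it is
    truncated there.\<close>
  define \<Lambda> where "\<Lambda> = \<omega> + 1"
  have \<Lambda>: "1 < \<Lambda>" using \<omega> by (simp add: \<Lambda>_def)
  have "continuous_on (cbox 0 \<Lambda>) (\<lambda>l::real. l\<^sup>2)" by (intro continuous_intros)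
  then obtain q :: "real \<Rightarrow>\<^sub>C real" where q': "\<And>l. l \<in> cbox 0 \<Lambda> \<Longrightarrow> q l = l\<^sup>2"
    by (rule continuous_on_cbox_bcontfunE) blast
  have q: "q l = l\<^sup>2" if "0 \<le> l" "l \<le> \<Lambda>" for l
    using that by (intro q') simp
  have b_abs: "\<bar>b t\<bar> \<le> \<beta>" if "t0 \<le> t" for t using b(2,3)[OF that] by simp
  obtain Y V :: "real \<Rightarrow> real \<Rightarrow>\<^sub>C real"
    where Y0: "Y t0 = const_bcontfun 1" and V0: "V t0 = const_bcontfun 0"
    and Y: "\<And>t. t0 \<le> t \<Longrightarrow> (Y has_vector_derivative V t) (at t within {t0..})"
    and V: "\<And>t. t0 \<le> t \<Longrightarrow> (V has_vector_derivative - b t *\<^sub>R V t - bcontfun_mult q (Y t))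
                             (at t within {t0..})"
    using damped_family_exists[OF b(1) b_abs] by metis
  note YV = damped_family_at_parameter[OF Y V]
  have q\<omega>: "q \<omega> = \<omega>\<^sup>2" using \<omega> by (intro q) (auto simp: \<Lambda>_def)
  have at_\<omega>: "Y t \<omega> = y t" "V t \<omega> = v t"
    using damped_ode_unique[of t0 b \<omega> "\<lambda>t. Y t \<omega>" "\<lambda>t. V t \<omega>" y v, OF b(2) _ _ _ y v _ _ t]
      YV[of _ \<omega>] \<omega> init Y0 V0 q\<omega> by auto
  define e where "e l = (V t l)\<^sup>2 + l\<^sup>2 * (Y t l)\<^sup>2" for l
  define E where "E = (v t)\<^sup>2 + \<omega>\<^sup>2 * (y t)\<^sup>2"
  have e\<omega>: "e \<omega> = E" by (simp add: e_def E_def at_\<omega>)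
  have "continuous_on UNIV e" unfolding e_def by (intro continuous_intros) auto
  then have "isCont e \<omega>" by (simp add: continuous_on_eq_continuous_at)
  moreover have "0 < E / 2" using pos by (simp add: E_def)
  ultimately obtain d where d: "0 < d" "\<And>l. \<bar>l - \<omega>\<bar> < d \<Longrightarrow> \<bar>e l - e \<omega>\<bar> < E / 2"
    unfolding continuous_at_real_range by (metis real_norm_def)
  define \<delta> where "\<delta> = min d 1"
  have \<delta>: "0 < \<delta>" using d by (simp add: \<delta>_def)
  \<comment> \<open>As $\lambda\leq\Lambda$ on the support of the data, this value of $|f|^2$ satisfies their
    constraint.\<close>
  define \<kappa> where "\<kappa> = 1 / (\<Lambda>\<^sup>2 + 1)"
  have \<kappa>: "0 < \<kappa>" unfolding \<kappa>_def by (intro divide_pos_pos add_nonneg_pos) auto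
  obtain f where f: "f \<in> L2 M" and f_int: "(\<integral>\<xi>. (f \<xi>)\<^sup>2 \<partial>M) = \<kappa>"
    and f_supp: "\<And>\<xi>. f \<xi> \<noteq> 0 \<Longrightarrow> \<bar>lam \<xi> - \<omega>\<bar> < \<delta>"
    using concentrated_function_exists[OF isometry_L2[OF iso] lam charge[OF \<delta>], of \<kappa>] \<kappa>
    by (metis less_imp_le)
  note [measurable] = L2D(1)[OF f]
  have lam_le: "lam \<xi> \<le> \<Lambda>" if "f \<xi> \<noteq> 0" for \<xi>
    using f_supp[OF that] by (simp add: \<delta>_def \<Lambda>_def abs_less_iff)
  have meas [measurable]: "(\<lambda>\<xi>. apply_bcontfun g (lam \<xi>)) \<in> borel_measurable M" for g :: "real \<Rightarrow>\<^sub>C real"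
    by (rule measurable_compose[OF lam])
       (intro borel_measurable_continuous_onI continuous_on_apply_bcontfun)
  have Lf_bound: "\<bar>lam \<xi> * f \<xi>\<bar> \<le> \<Lambda> * \<bar>f \<xi>\<bar>" if "\<xi> \<in> space M" for \<xi>
    using lam0[OF that] lam_le[of \<xi>] by (cases "f \<xi> = 0") (auto simp: abs_mult mult_right_mono)
  have Lf: "(\<lambda>\<xi>. lam \<xi> * f \<xi>) \<in> L2 M"
    by (rule L2_dominated[OF f _ Lf_bound]) measurable
  obtain T :: "(real \<Rightarrow>\<^sub>C real) \<Rightarrow> 'h" where T: "bounded_linear T"
    and FT: "\<And>g. AE \<xi> in M. F (T g) \<xi> = f \<xi> * g (lam \<xi>)"
    using frequency_multiplier_map[OF iso f lam] by metis
  have AT: "(norm (op_power M lam F (1/2) (T g)))\<^sup>2 = (\<integral>\<xi>. (lam \<xi> * f \<xi> * g (lam \<xi>))\<^sup>2 \<partial>M)"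
    for g :: "real \<Rightarrow>\<^sub>C real"
  proof -
    obtain S :: "(real \<Rightarrow>\<^sub>C real) \<Rightarrow> 'h"
      where FS: "\<And>g. AE \<xi> in M. F (S g) \<xi> = (lam \<xi> * f \<xi>) * g (lam \<xi>)"
      using frequency_multiplier_map[OF iso Lf lam] by metis
    have "AE \<xi> in M. F (S g) \<xi> = lam \<xi> powr (2 * (1/2)) * F (T g) \<xi>"
      using FS[of g] FT[of g] AE_space by eventually_elim (simp add: lam0)
    then have "op_power M lam F (1/2) (T g) = S g" by (rule op_power_eqI[OF iso])
    then show ?thesis
      using isometry_norm[OF iso FS[of g]] by simp
  qed
  define u where "u s = T (Y s)" for s
  have Fu0: "AE \<xi> in M. F (u t0) \<xi> = f \<xi>"
    using FT[of "Y t0"] by (simp add: u_def Y0)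
  have Fu1: "AE \<xi> in M. F (T (V t0)) \<xi> = 0"
    using FT[of "V t0"] by (simp add: V0)
  have u1: "T (V t0) = 0"
    by (rule isometry_eq_zero[OF iso Fu1])

  have dom: "u t0 \<in> dom_power M lam F (1/2)"
    unfolding dom_power_def mem_Collect_eq
  proof (rule integrable_cong_AE_imp[OF L2D(2)[OF Lf]])
    show "AE \<xi> in M. (lam \<xi> * f \<xi>)\<^sup>2 = lam \<xi> powr (4 * (1/2)) * (F (u t0) \<xi>)\<^sup>2"
      using Fu0 AE_space by eventually_elim (simp add: lam0 power_mult_distrib)
  qed measurable

  have data: "(norm (T (V t0)))\<^sup>2 + (norm (op_power M lam F (1/2) (u t0)))\<^sup>2 + (norm (u t0))\<^sup>2 \<le> 1"
  proof -
    have "(norm (op_power M lam F (1/2) (u t0)))\<^sup>2 = (\<integral>\<xi>. (lam \<xi> * f \<xi>)\<^sup>2 \<partial>M)"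
      unfolding u_def AT by (simp add: Y0)
    also have "\<dots> \<le> (\<integral>\<xi>. \<Lambda>\<^sup>2 * (f \<xi>)\<^sup>2 \<partial>M)"
    proof (rule integral_mono')
      show "integrable M (\<lambda>\<xi>. \<Lambda>\<^sup>2 * (f \<xi>)\<^sup>2)" using L2D(2)[OF f] by simp
      fix \<xi> assume "\<xi> \<in> space M"
      then have "\<bar>lam \<xi> * f \<xi>\<bar>\<^sup>2 \<le> (\<Lambda> * \<bar>f \<xi>\<bar>)\<^sup>2"
        using Lf_bound by (intro power_mono) auto
      then show "(lam \<xi> * f \<xi>)\<^sup>2 \<le> \<Lambda>\<^sup>2 * (f \<xi>)\<^sup>2"
        by (simp add: power_mult_distrib)
    qed auto
    also have "\<dots> = \<Lambda>\<^sup>2 * \<kappa>" by (simp add: f_int)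
    finally have "(norm (op_power M lam F (1/2) (u t0)))\<^sup>2 \<le> \<Lambda>\<^sup>2 * \<kappa>" .
    moreover have "(norm (u t0))\<^sup>2 = \<kappa>"
      using isometry_norm[OF iso Fu0] f_int by simp
    moreover have "\<Lambda>\<^sup>2 * \<kappa> + \<kappa> = (\<Lambda>\<^sup>2 + 1) * \<kappa>" by (simp add: distrib_right)
    moreover have "(\<Lambda>\<^sup>2 + 1) * \<kappa> = 1"
      unfolding \<kappa>_def by (simp add: add_nonneg_eq_0_iff)
    ultimately show ?thesis by (simp add: u1)
  qed

  have sol: "wave_solution M lam F t0 b (u t0) (T (V t0)) u"
  proof -
    \<comment> \<open>The representatives of the data are prescribed only almost everywhere, but the
      oscillator equation is required at every point: on the exceptional set any solution with
      the data found there will do.\<close>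
    define w where "w s \<xi> =
      (if F (u t0) \<xi> = f \<xi> \<and> F (T (V t0)) \<xi> = 0 then f \<xi> * Y s (lam \<xi>)
       else (SOME z. damped_ode_solution t0 b (lam \<xi>) (F (u t0) \<xi>) (F (T (V t0)) \<xi>) z) s)" for s \<xi>
    have "damped_ode_solution t0 b (lam \<xi>) (F (u t0) \<xi>) (F (T (V t0)) \<xi>) (\<lambda>s. w s \<xi>)"
      if \<xi>: "\<xi> \<in> space M" for \<xi>
    proof (cases "F (u t0) \<xi> = f \<xi> \<and> F (T (V t0)) \<xi> = 0")
      case True
      have "f \<xi> * q (lam \<xi>) = f \<xi> * (lam \<xi>)\<^sup>2"
        using q[OF lam0[OF \<xi>]] lam_le[of \<xi>] by (cases "f \<xi> = 0") auto
      then have eq2: "f \<xi> * (- b s * V s (lam \<xi>) - q (lam \<xi>) * Y s (lam \<xi>))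
          = - b s * (f \<xi> * V s (lam \<xi>)) - (lam \<xi>)\<^sup>2 * (f \<xi> * Y s (lam \<xi>))" for s
        by algebra
      have "((\<lambda>s. f \<xi> * Y s (lam \<xi>)) has_real_derivative f \<xi> * V s (lam \<xi>)) (at s within {t0..})"
        "((\<lambda>s. f \<xi> * V s (lam \<xi>)) has_real_derivative
            - b s * (f \<xi> * V s (lam \<xi>)) - (lam \<xi>)\<^sup>2 * (f \<xi> * Y s (lam \<xi>))) (at s within {t0..})"
        if "t0 \<le> s" for s
        unfolding eq2[symmetric] using YV[OF _ _ that, of "lam \<xi>"] by (auto intro: DERIV_cmult)
      then show ?thesis
        using True unfolding damped_ode_solution_def w_def
        by (intro exI[of _ "\<lambda>s. f \<xi> * V s (lam \<xi>)"]) (simp add: Y0 V0)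
    next
      case False
      then have "(\<lambda>s. w s \<xi>)
          = (SOME z. damped_ode_solution t0 b (lam \<xi>) (F (u t0) \<xi>) (F (T (V t0)) \<xi>) z)"
        unfolding w_def by (simp only: if_False)
      then show ?thesis
        by (simp only: someI_ex[OF damped_ode_solution_exists[OF b(1) b_abs]])
    qed
    moreover have "AE \<xi> in M. F (u s) \<xi> = w s \<xi>" for s
      using Fu0 Fu1 FT[of "Y s"] by eventually_elim (simp add: w_def u_def)
    ultimately show ?thesis unfolding wave_solution_def by blast
  qed

  have "(u has_vector_derivative T (V t)) (at t within {t0..})"
    unfolding u_def by (rule bounded_linear.has_vector_derivative[OF T Y[OF t]])
  then have deriv: "vector_derivative u (at t within {t0..}) = T (V t)"
    using vector_derivative_within_cbox[of t0 "t + 1" t u "T (V t)"] t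
    by (simp add: at_within_atLeast_eq_atLeastAtMost[of t "t + 1"])

  have L2Y: "(\<lambda>\<xi>. lam \<xi> * f \<xi> * Y t (lam \<xi>)) \<in> L2 M"
  proof (rule L2_dominated[OF Lf])
    show "\<bar>lam \<xi> * f \<xi> * Y t (lam \<xi>)\<bar> \<le> norm (Y t) * \<bar>lam \<xi> * f \<xi>\<bar>" for \<xi>
      using mult_left_mono[OF norm_bounded[of "Y t" "lam \<xi>"], of "\<bar>lam \<xi> * f \<xi>\<bar>"]
      by (simp add: abs_mult mult_ac)
  qed measurable
  have L2V: "(\<lambda>\<xi>. f \<xi> * V t (lam \<xi>)) \<in> L2 M"
  proof (rule L2_dominated[OF f])
    show "\<bar>f \<xi> * V t (lam \<xi>)\<bar> \<le> norm (V t) * \<bar>f \<xi>\<bar>" for \<xi>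
      using mult_left_mono[OF norm_bounded[of "V t" "lam \<xi>"], of "\<bar>f \<xi>\<bar>"]
      by (simp add: abs_mult mult_ac)
  qed measurable
  have "E / 2 * \<kappa> = (\<integral>\<xi>. E / 2 * (f \<xi>)\<^sup>2 \<partial>M)" by (simp add: f_int)
  also have "\<dots> \<le> (\<integral>\<xi>. (f \<xi> * V t (lam \<xi>))\<^sup>2 + (lam \<xi> * f \<xi> * Y t (lam \<xi>))\<^sup>2 \<partial>M)"
  proof (rule integral_mono)
    fix \<xi>
    have "E / 2 * (f \<xi>)\<^sup>2 \<le> e (lam \<xi>) * (f \<xi>)\<^sup>2"
    proof (cases "f \<xi> = 0")
      case False
      then have "\<bar>e (lam \<xi>) - E\<bar> < E / 2"
        using d(2)[of "lam \<xi>"] f_supp[OF False] by (simp add: \<delta>_def e\<omega>)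
      then have "E / 2 \<le> e (lam \<xi>)" by linarith
      then show ?thesis by (intro mult_right_mono) auto
    qed simp
    also have "\<dots> = (f \<xi> * V t (lam \<xi>))\<^sup>2 + (lam \<xi> * f \<xi> * Y t (lam \<xi>))\<^sup>2"
      by (simp add: e_def power_mult_distrib algebra_simps)
    finally show "E / 2 * (f \<xi>)\<^sup>2 \<le> (f \<xi> * V t (lam \<xi>))\<^sup>2 + (lam \<xi> * f \<xi> * Y t (lam \<xi>))\<^sup>2" .
  qed (use L2D(2)[OF f] L2D(2)[OF L2V] L2D(2)[OF L2Y] in auto)
  also have "\<dots> = (norm (T (V t)))\<^sup>2 + (norm (op_power M lam F (1/2) (u t)))\<^sup>2"
    unfolding u_def AT using isometry_norm[OF iso FT[of "V t"]] L2D(2)[OF L2V] L2D(2)[OF L2Y]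
    by simp
  finally have "ereal (E / 2 * \<kappa>) \<le> ereal ((norm (vector_derivative u (at t within {t0..})))\<^sup>2
                 + (norm (op_power M lam F (1/2) (u t)))\<^sup>2)"
    by (simp add: deriv)
  also have "\<dots> \<le> max_energy M lam F t0 b t"
    unfolding max_energy_def by (rule Sup_upper) (use dom data sol in blast)
  finally show ?thesis by (simp add: E_def \<kappa>_def \<Lambda>_def)
qed

theorem theorem2p5:
  fixes D :: "'h::{real_inner,complete_space} set"
    and A :: "'h \<Rightarrow> 'h"
    and M :: "'m measure"
    and lam :: "'m \<Rightarrow> real"
    and F :: "'h \<Rightarrow> 'm \<Rightarrow> real"
    and t0 a r :: real
  assumes "linear_operator D A"
    and "equivalent_to_multiplication D A M lam F"
    and "\<exists>u\<in>D. A u \<noteq> 0"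
    and "0 < t0"
    and "0 < r" and "r \<le> a"
  shows "\<exists>b :: real \<Rightarrow> real.
     C_infinity_on {t0..} b \<and>
     (\<forall>t\<ge>t0. (a - r) / t \<le> b t \<and> b t \<le> (a + r) / t) \<and>
     (\<exists>L::real. ((\<lambda>t. (t0 / t) powr a * exp (integral {t0..t} b)) \<longlongrightarrow> L) at_top) \<and>
     (\<exists>\<Gamma>\<^sub>3>0. \<forall>t\<ge>t0. max_energy M lam F t0 b t \<ge> ereal (\<Gamma>\<^sub>3 / t powr (a - r / 2)))"
proof -
  obtain u where u: "u \<in> D" "A u \<noteq> 0" using assms(3) by auto
  obtain \<omega> where \<omega>: "0 < \<omega>"
    and charge: "\<And>\<delta>. 0 < \<delta> \<Longrightarrow> \<not> (AE \<xi> in M. \<bar>lam \<xi> - \<omega>\<bar> < \<delta> \<longrightarrow> F u \<xi> = 0)"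
    using positive_frequency_exists[of D A M lam F u, OF assms(2) u] by metis
  obtain b y v c where smooth: "C_infinity_on {t0..} b"
    and bounds: "\<And>t. t0 \<le> t \<Longrightarrow> (a - r) / t \<le> b t \<and> b t \<le> (a + r) / t"
    and limit: "\<exists>L. ((\<lambda>t. (t0 / t) powr a * exp (integral {t0..t} b)) \<longlongrightarrow> L) at_top"
    and init: "y t0 = 1" "v t0 = 0"
    and y: "\<And>t. t0 \<le> t \<Longrightarrow> (y has_real_derivative v t) (at t within {t0..})"
    and v: "\<And>t. t0 \<le> t \<Longrightarrow> (v has_real_derivative - b t * v t - \<omega>\<^sup>2 * y t) (at t within {t0..})"
    and c: "0 < c" "\<And>t. t0 \<le> t \<Longrightarrow> c / t powr (a - r / 2) \<le> (v t)\<^sup>2 + \<omega>\<^sup>2 * (y t)\<^sup>2"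
    using resonant_damping[OF assms(4) \<omega> assms(5,6)] by blast
  have cont: "continuous_on {t0..} b"
  proof -
    obtain d where d: "\<forall>t\<in>{t0..}. d 0 t = b t"
      "\<forall>n. \<forall>t\<in>{t0..}. (d n has_real_derivative d (Suc n) t) (at t within {t0..})"
      using smooth unfolding C_infinity_on_def by blast
    then have "continuous_on {t0..} (d 0)" by (intro DERIV_continuous_on) auto
    then show ?thesis by (rule continuous_on_eq) (use d(1) in auto)
  qed
  have nonneg: "0 \<le> b t" if "t0 \<le> t" for t
  proof -
    have "0 \<le> (a - r) / t" using assms(4,6) that by simp
    then show ?thesis using bounds[OF that] by linarith
  qed
  have le: "b t \<le> (a + r) / t0" if "t0 \<le> t" for t
  proof -
    have "(a + r) / t \<le> (a + r) / t0"
      using assms(4-6) that by (intro divide_left_mono) auto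
    then show ?thesis using bounds[OF that] by linarith
  qed
  define N where "N = 2 * ((\<omega> + 1)\<^sup>2 + 1)"
  have N: "0 < N" unfolding N_def by (intro mult_pos_pos add_nonneg_pos) auto
  have "ereal (c / N / t powr (a - r / 2)) \<le> max_energy M lam F t0 b t" if t: "t0 \<le> t" for t
  proof -
    have "0 < c / t powr (a - r / 2)" using c(1) assms(4) t by simp
    then have pos: "0 < (v t)\<^sup>2 + \<omega>\<^sup>2 * (y t)\<^sup>2" using c(2)[OF t] by linarith
    have "c / N / t powr (a - r / 2) = c / t powr (a - r / 2) / N" by simp
    also have "\<dots> \<le> ((v t)\<^sup>2 + \<omega>\<^sup>2 * (y t)\<^sup>2) / N"
      using c(2)[OF t] N by (intro divide_right_mono) auto
    finally have "ereal (c / N / t powr (a - r / 2)) \<le> ereal (((v t)\<^sup>2 + \<omega>\<^sup>2 * (y t)\<^sup>2) / N)"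
      by simp
    also have "\<dots> \<le> max_energy M lam F t0 b t"
      unfolding N_def
      by (rule max_energy_ge_frequency_energy[OF assms(2) \<omega> charge cont nonneg le y v init t pos])
    finally show ?thesis .
  qed
  moreover have "0 < c / N" using c(1) N by simp
  ultimately show ?thesis using smooth bounds limit by blast
qed

end
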